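(* Let $\kappa_0\in(0,1)$, $\varepsilon>0$, and let $f\in L^1_2(\mathbb{R}^3)\setminus\{0\}$ be nonnegative with $1-\varepsilon f\ge\kappa_0$. Then $$H_0\left[\left.\frac{f}{1-\varepsilon f}\right|M^{\frac{f}{1-\varepsilon f}}\right]\ \leq\ C_0(\kappa_0)\,H_\varepsilon\left[f\,|\,\mathcal{M}_\varepsilon^f\right],\qquad C_0(\kappa_0)=\exp\left(16\,(\kappa_0^{-1}-1)\right).$$
   Context: $L^1_2(\mathbb{R}^3)$ is the set of measurable $g$ with $\int_{\mathbb{R}^3}|g(v)|(1+|v|^2)\,dv<\infty$. Moments: for nonnegative $f\in L^1_2(\mathbb{R}^3)\setminus\{0\}$, $(\rho,u,T)\in(0,\infty)\times\mathbb{R}^3\times(0,\infty)$ are defined by $\int f\,dv=\rho$, $\int f v\,dv=\rho u$, $\int f|v|^2\,dv=3\rho T+\rho|u|^2$. Equilibria: for $\varepsilon\ge0$, an $\varepsilon$-Fermi-Dirac distribution (Maxwellian if $\varepsilon=0$) is a function $v\mapsto \frac{e^{a+b|v-\bar u|^2}}{1+\varepsilon e^{a+b|v-\bar u|^2}}$ with $a\in\mathbb{R}$, $\bar u\in\mathbb{R}^3$, $b<0$. $\mathcal{M}_\varepsilon^f$ denotes the unique $\varepsilon$-Fermi-Dirac distribution having the same integrals against $1$, $v$, $|v|^2$ as $f$; for $\varepsilon>0$ and $1-\varepsilon f\ge 0$ it is known to exist iff $\gamma:=T/T_F(\rho,\varepsilon)>\frac25$, where $T_F(\rho,\varepsilon)=\frac12\left(\frac{3\varepsilon\rho}{4\pi}\right)^{2/3}$;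 moreover $\gamma\ge\frac25$ always holds, with equality iff $f=\varepsilon^{-1}\mathbf 1_{|\cdot-u|\le(3\varepsilon\rho/4\pi)^{1/3}}$ (so $1-\varepsilon f\ge\kappa_0>0$ implies $\gamma>\frac25$). The Maxwellian associated with $g$ is $M^g:=\mathcal{M}_0^g$. Entropy: $\varphi_\varepsilon(x)=\frac{x}{1-\varepsilon x}$ and $\Phi_\varepsilon(x)=\int_0^x\log\varphi_\varepsilon(y)\,dy$ for $x\ge0$ with $1-\varepsilon x\ge0$ (so $\Phi_0(x)=x\log x-x$ and, for $\varepsilon>0$, $\Phi_\varepsilon(x)=x\log x+\varepsilon^{-1}(1-\varepsilon x)\log(1-\varepsilon x)$, with $0\log0=0$). $H_\varepsilon(f)=\int_{\mathbb{R}^3}\Phi_\varepsilon(f(v))\,dv$ and $H_\varepsilon[f|g]=H_\varepsilon(f)-H_\varepsilon(g)$. *)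

theory Defs
  imports "HOL-Analysis.Analysis"
begin

definition L12 :: "(real^3 \<Rightarrow> real) set" where
  "L12 = {g. g \<in> borel_measurable lebesgue \<and>
             integrable lebesgue (\<lambda>v. \<bar>g v\<bar> * (1 + (norm v)\<^sup>2))}"

definition fermi_dirac_dist :: "real \<Rightarrow> (real^3 \<Rightarrow> real) \<Rightarrow> bool" where
  "fermi_dirac_dist \<epsilon> M \<longleftrightarrow>
     (\<exists>(a::real) (b::real) (w::real^3). b < 0 \<and>
        M = (\<lambda>v. exp (a + b * (norm (v - w))\<^sup>2) / (1 + \<epsilon> * exp (a + b * (norm (v - w))\<^sup>2))))"

definition same_moments :: "(real^3 \<Rightarrow> real) \<Rightarrow> (real^3 \<Rightarrow> real) \<Rightarrow> bool" where
  "same_moments f g \<longleftrightarrow>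
     (LINT v|lebesgue. f v) = (LINT v|lebesgue. g v) \<and>
     (LINT v|lebesgue. f v *\<^sub>R v) = (LINT v|lebesgue. g v *\<^sub>R v) \<and>
     (LINT v|lebesgue. f v * (norm v)\<^sup>2) = (LINT v|lebesgue. g v * (norm v)\<^sup>2)"

definition equilibrium :: "real \<Rightarrow> (real^3 \<Rightarrow> real) \<Rightarrow> (real^3 \<Rightarrow> real)" where
  "equilibrium \<epsilon> f = (THE M. fermi_dirac_dist \<epsilon> M \<and> same_moments M f)"

definition maxwellian :: "(real^3 \<Rightarrow> real) \<Rightarrow> (real^3 \<Rightarrow> real)" where
  "maxwellian g = equilibrium 0 g"

definition phi_fd :: "real \<Rightarrow> real \<Rightarrow> real" where
  "phi_fd \<epsilon> x = x / (1 - \<epsilon> * x)"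

(* Meaningful for x \<ge> 0 with 1 - \<epsilon> * x \<ge> 0. The integrand's singularities at the end points
   are integrable, and its (totalised) values there do not affect the integral. *)
definition Phi_fd :: "real \<Rightarrow> real \<Rightarrow> real" where
  "Phi_fd \<epsilon> x = integral {0..x} (\<lambda>y. ln (phi_fd \<epsilon> y))"

definition entropy_fd :: "real \<Rightarrow> (real^3 \<Rightarrow> real) \<Rightarrow> real" where
  "entropy_fd \<epsilon> f = (LINT v|lebesgue. Phi_fd \<epsilon> (f v))"

definition rel_entropy_fd :: "real \<Rightarrow> (real^3 \<Rightarrow> real) \<Rightarrow> (real^3 \<Rightarrow> real) \<Rightarrow> real" where
  "rel_entropy_fd \<epsilon> f g = entropy_fd \<epsilon> f - entropy_fd \<epsilon> g"

definition C0 :: "real \<Rightarrow> real" where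
  "C0 \<kappa> = exp (16 * (inverse \<kappa> - 1))"

end

theory Submission
  imports Defs "HOL-Probability.Distributions"
begin

text \<open>
  Write \<open>\<phi>\<^sub>\<epsilon> x = x / (1 - \<epsilon> x)\<close>, so that the density of \<open>H\<^sub>\<epsilon>\<close> has derivative
  \<open>ln (\<phi>\<^sub>\<epsilon> x)\<close>. The map \<open>\<phi>\<^sub>\<epsilon>\<close> sends the Fermi-Dirac distribution with parameters
  \<open>a, \<beta>, w\<close> to the Maxwellian with the same parameters, whose logarithm is a quadratic polynomial
  in \<open>v\<close>. Moments up to order two therefore do not distinguish \<open>H\<^sub>\<epsilon>(f) - H\<^sub>\<epsilon>(M)\<close> from the integral
  of the Bregman divergence \<open>bregman \<epsilon> (f v) (M v)\<close> when \<open>M\<close> is the equilibrium of \<open>f\<close>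
  (\<open>relative_entropy_eq_bregman\<close>), and for every other distribution in place of \<open>M\<close> that integral
  can only be larger (\<open>relative_entropy_le_bregman\<close>).

  Let \<open>M\<close> be the equilibrium of \<open>f\<close>. Since \<open>\<phi>\<^sub>\<epsilon> \<circ> M\<close> is a Maxwellian, though not the one of
  \<open>\<phi>\<^sub>\<epsilon> \<circ> f\<close>, the left-hand side is at most the integral of
  \<open>bregman 0 (\<phi>\<^sub>\<epsilon> (f v)) (\<phi>\<^sub>\<epsilon> (M v))\<close>. Substituting \<open>\<phi>\<^sub>\<epsilon>\<close> in the integral formula for the
  divergence multiplies the integrand by \<open>\<phi>\<^sub>\<epsilon>' x = 1 / (1 - \<epsilon> x)\<^sup>2\<close>; hence this is at most \<open>C\<close> times
  \<open>bregman \<epsilon> (f v) (M v)\<close> as soon as \<open>C\<close> bounds \<open>\<phi>\<^sub>\<epsilon>'\<close> on the values of \<open>f\<close> and of \<open>M\<close>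
  (\<open>bregman_phi_le\<close>). For \<open>f\<close> the hypothesis \<open>1 - \<epsilon> f \<ge> \<kappa>\<^sub>0\<close> gives \<open>\<kappa>\<^sub>0\<^sup>-\<^sup>2\<close>. For \<open>M\<close> one needs
  \<open>1 / (1 - \<epsilon> M) \<le> 1 + \<epsilon> exp a \<le> exp (8 (1 / \<kappa>\<^sub>0 - 1))\<close>, which is \<open>fermi_dirac_fugacity_bound\<close>;
  the square of this bound is the constant \<open>C0 \<kappa>\<^sub>0\<close>.

  The fugacity bound compares the second moments of \<open>f\<close> and \<open>M\<close>. Put \<open>h = 1 - \<kappa>\<^sub>0\<close>. As
  \<open>\<epsilon> f \<le> h\<close>, integrating \<open>\<epsilon> f\<close> against \<open>R\<^sup>2 - |v - w|\<^sup>2\<close> gives at most \<open>h\<close> times the integral of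
  its positive part (\<open>bathtub\<close>). The same number can be computed from \<open>M\<close>; after rescaling
  and in polar coordinates it is a multiple of a value of \<open>ball_test\<close>, and for a suitable
  \<open>R\<close> it is at least the fraction \<open>L / (8 + L)\<close> of the integral of the positive part, where \<open>L = ln (1 + \<epsilon> exp a)\<close>
  (\<open>ball_test_lower_bound\<close>). So \<open>L / (8 + L) \<le> h\<close>, that is \<open>L \<le> 8 h / (1 - h)\<close>.

  The equilibria are defined by a description, so they have to be shown to exist and to be unique.
  Uniqueness is strict monotonicity of the profile in its exponent. Existence of the Fermi-Dirac
  equilibrium follows from the intermediate value theorem in \<open>a\<close>: matching the mass fixes the
  length scale, and the resulting energy exceeds any bound for dilute profiles, while for large
  \<open>a\<close> the lower bound on \<open>ball_test\<close> pushes it below the energy of \<open>f\<close>.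
\<close>

section \<open>Integrals on the half line\<close>

text \<open>
  The integrand may change sign, so the improper integral is reached from the compact intervals
  by dominated convergence, with the integrand itself as majorant.
\<close>
lemma integral_halfline_FTC:
  fixes f F :: "real \<Rightarrow> real"
  assumes deriv: "\<And>r. c \<le> r \<Longrightarrow> (F has_real_derivative f r) (at r)"
    and cont: "continuous_on UNIV f"
    and int: "integrable lborel (\<lambda>r. indicator {c..} r * f r)"
    and lim: "(F \<longlongrightarrow> T) at_top"
  shows "(LINT r|lborel. indicator {c..} r * f r) = T - F c"
proof -
  have "((\<lambda>t. LINT r|lborel. indicator {c..t} r * f r) \<longlongrightarrow> (LINT r|lborel. indicator {c..} r * f r)) at_top"
  proof (rule integral_dominated_convergence_at_top[where w="\<lambda>r. \<bar>indicator {c..} r * f r\<bar>"])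
    have [measurable]: "f \<in> borel_measurable borel"
      using cont by (rule borel_measurable_continuous_onI)
    show "(\<lambda>r. indicator {c..} r * f r) \<in> borel_measurable lborel" by measurable
    show "(\<lambda>r. indicator {c..t} r * f r) \<in> borel_measurable lborel" for t by measurable
    show "integrable lborel (\<lambda>r. \<bar>indicator {c..} r * f r\<bar>)" using int by simp
    have "\<forall>\<^sub>F t in at_top. indicator {c..t} r * f r = indicator {c..} r * f r" for r
      using eventually_ge_at_top[of r] by eventually_elim (auto split: split_indicator)
    then show "AE r in lborel. ((\<lambda>t. indicator {c..t} r * f r) \<longlongrightarrow> indicator {c..} r * f r) at_top"
      by (intro AE_I2 tendsto_eventually)
    show "\<forall>\<^sub>F t in at_top. AE r in lborel. norm (indicator {c..t} r * f r) \<le> \<bar>indicator {c..} r * f r\<bar>"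
      by (auto split: split_indicator)
  qed
  moreover have "\<forall>\<^sub>F t in at_top. (LINT r|lborel. indicator {c..t} r * f r) = F t - F c"
    using eventually_ge_at_top[of c]
  proof eventually_elim
    case (elim t)
    have "(LINT r|lborel. f r * indicator {c..t} r) = F t - F c"
      using cont by (intro integral_FTC_Icc_real elim) (auto intro: deriv simp: continuous_on_eq_continuous_at)
    then show ?case by (simp add: mult.commute)
  qed
  ultimately have "((\<lambda>t. F t - F c) \<longlongrightarrow> (LINT r|lborel. indicator {c..} r * f r)) at_top"
    by (simp add: filterlim_cong)
  moreover have "((\<lambda>t. F t - F c) \<longlongrightarrow> T - F c) at_top"
    using lim by (intro tendsto_intros)
  ultimately show ?thesis
    by (metis tendsto_unique trivial_limit_at_top_linorder)
qed

lemma has_bochner_integral_halfline_gaussian: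
  assumes "0 < l"
  shows "has_bochner_integral lborel (\<lambda>r. indicator {0..} r * exp (- (l * r\<^sup>2))) (sqrt pi / 2 / sqrt l)"
    and "has_bochner_integral lborel (\<lambda>r. indicator {0..} r * (r\<^sup>2 * exp (- (l * r\<^sup>2)))) (sqrt pi / 4 / (l * sqrt l))"
proof -
  have s: "sqrt l > 0" "sqrt l \<noteq> 0" "sqrt l * sqrt l = l" "(sqrt l)\<^sup>2 = l" using assms by auto
  have i: "indicator {0..} (sqrt l * r) = (indicator {0..} r :: real)" for r
    using s by (auto simp: indicator_def zero_le_mult_iff)
  have scale: "has_bochner_integral lborel (\<lambda>r. g (sqrt l * r)) (x / sqrt l)"
    if "has_bochner_integral lborel g x" for g :: "real \<Rightarrow> real" and x
    using iffD1[OF lborel_has_bochner_integral_real_affine_iff[OF s(2), where t=0] that] s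
    by (simp add: divide_inverse mult.commute)
  show "has_bochner_integral lborel (\<lambda>r. indicator {0..} r * exp (- (l * r\<^sup>2))) (sqrt pi / 2 / sqrt l)"
    using scale[OF gaussian_moment_0] s(4) by (simp add: i power_mult_distrib)
  have "has_bochner_integral lborel (\<lambda>r. indicator {0..} r * (exp (- (r\<^sup>2)) * r\<^sup>2)) (sqrt pi / 4)"
    using gaussian_moment_even_pos[of 1] by simp
  from has_bochner_integral_divide_zero[OF scale[OF this], of l]
  have "has_bochner_integral lborel (\<lambda>r. indicator {0..} r * (exp (- (l * r\<^sup>2)) * (l * r\<^sup>2)) / l)
     (sqrt pi / 4 / sqrt l / l)"
    using s(4) by (simp add: i power_mult_distrib)
  moreover have "(\<lambda>r. indicator {0..} r * (exp (- (l * r\<^sup>2)) * (l * r\<^sup>2)) / l) =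
      (\<lambda>r. indicator {0..} r * (r\<^sup>2 * exp (- (l * r\<^sup>2))))"
    using assms by (simp add: fun_eq_iff)
  moreover have "sqrt pi / 4 / sqrt l / l = sqrt pi / 4 / (l * sqrt l)" by (simp add: mult.commute)
  ultimately show "has_bochner_integral lborel (\<lambda>r. indicator {0..} r * (r\<^sup>2 * exp (- (l * r\<^sup>2)))) (sqrt pi / 4 / (l * sqrt l))"
    by (simp only:)
qed

lemma integrable_halfline_gaussian:
  "integrable lborel (\<lambda>r::real. indicator {0..} r * (r ^ k * exp (- r\<^sup>2)) :: real)"
proof (cases "even k")
  case True
  then obtain n where "k = 2 * n" by (auto elim: evenE)
  then show ?thesis using gaussian_moment_even_pos[of n] by (auto simp: has_bochner_integral_iff mult.commute)
next
  case False
  then obtain n where "k = 2 * n + 1" by (auto elim: oddE)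
  then show ?thesis using gaussian_moment_odd_pos[of n] by (auto simp: has_bochner_integral_iff mult.commute)
qed

lemma tendsto_power_gaussian_at_top: "((\<lambda>r::real. r ^ k * exp (- r\<^sup>2)) \<longlongrightarrow> 0) at_top"
proof (rule Lim_null_comparison)
  show "\<forall>\<^sub>F r in at_top. norm (r ^ k * exp (- r\<^sup>2)) \<le> r ^ k / exp r" 
    using eventually_ge_at_top[of 1]
  proof eventually_elim
    case (elim r)
    then have "r \<le> r\<^sup>2" by (simp add: power2_eq_square)
    then have "exp (- r\<^sup>2) \<le> exp (- r)" by simp
    then show ?case using elim by (simp add: exp_minus divide_inverse abs_mult mult_left_mono)
  qed
  show "((\<lambda>r::real. r ^ k / exp r) \<longlongrightarrow> 0) at_top" by (rule tendsto_power_div_exp_0)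
qed

section \<open>Fermi-Dirac profiles on the half line\<close>

definition fd_profile :: "real \<Rightarrow> real \<Rightarrow> real \<Rightarrow> real" where
  "fd_profile \<epsilon> a x = exp (a - x) / (1 + \<epsilon> * exp (a - x))"

lemma fd_denom_pos: "0 \<le> \<epsilon> \<Longrightarrow> 0 < 1 + \<epsilon> * exp (y::real)"
  by (simp add: add_pos_nonneg)

lemma fd_profile_pos: "0 \<le> \<epsilon> \<Longrightarrow> 0 < fd_profile \<epsilon> a x"
  by (simp add: fd_profile_def add_pos_nonneg)

lemma fd_profile_le_exp: "0 \<le> \<epsilon> \<Longrightarrow> fd_profile \<epsilon> a x \<le> exp a * exp (- x)"
  using fd_denom_pos[of \<epsilon> "a - x"]
  by (simp add: fd_profile_def divide_le_eq exp_diff exp_minus field_simps)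

lemma continuous_on_fd_profile [continuous_intros]:
  assumes "0 \<le> \<epsilon>" "continuous_on S p" "continuous_on S q"
  shows "continuous_on S (\<lambda>v. fd_profile \<epsilon> (p v) (q v))"
  unfolding fd_profile_def using assms fd_denom_pos[OF assms(1)]
  by (intro continuous_intros) (auto simp: less_le)

lemma measurable_fd_profile [measurable]:
  assumes [measurable]: "p \<in> borel_measurable M" "q \<in> borel_measurable M"
  shows "(\<lambda>v. fd_profile \<epsilon> (p v) (q v)) \<in> borel_measurable M"
  unfolding fd_profile_def by measurable

lemma integrable_halfline_fd:
  assumes "0 \<le> \<epsilon>"
  shows "integrable lborel (\<lambda>r. indicator {0..} r * (r ^ k * fd_profile \<epsilon> a (r\<^sup>2)))"
proof (rule Bochner_Integration.integrable_bound)
  show "integrable lborel (\<lambda>r. exp a * (indicator {0..} r * (r ^ k * exp (- r\<^sup>2))))"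
    by (intro integrable_mult_right integrable_halfline_gaussian)
  show "AE r in lborel. norm (indicator {0..} r * (r ^ k * fd_profile \<epsilon> a (r\<^sup>2)))
      \<le> norm (exp a * (indicator {0..} r * (r ^ k * exp (- r\<^sup>2))))"
  proof (rule AE_I2)
    fix r :: real
    have "\<bar>r ^ k\<bar> * fd_profile \<epsilon> a (r\<^sup>2) \<le> \<bar>r ^ k\<bar> * (exp a * exp (- r\<^sup>2))"
      using fd_profile_le_exp[OF assms, of a "r\<^sup>2"] by (intro mult_left_mono) auto
    then show "norm (indicator {0..} r * (r ^ k * fd_profile \<epsilon> a (r\<^sup>2)))
      \<le> norm (exp a * (indicator {0..} r * (r ^ k * exp (- r\<^sup>2))))"
      using fd_profile_pos[OF assms, of a "r\<^sup>2"]
      by (auto simp: abs_mult ac_simps split: split_indicator)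
  qed
qed measurable

text \<open>
  The integral of the profile against \<open>R\<^sup>2 - |v|\<^sup>2\<close> over the whole space, in polar coordinates and
  up to the factor \<open>4 * pi\<close>. The corresponding integral of the indicator function of the ball of
  radius \<open>R\<close> is \<open>2 / 15 * R ^ 5\<close>.
\<close>
definition ball_test :: "real \<Rightarrow> real \<Rightarrow> real" where
  "ball_test a R = (LINT r|lborel. indicator {0..} r * (r\<^sup>2 * (R\<^sup>2 - r\<^sup>2) * fd_profile 1 a (r\<^sup>2)))"

lemma integrable_ball_test:
  "integrable lborel (\<lambda>r. indicator {0..} r * (r\<^sup>2 * (R\<^sup>2 - r\<^sup>2) * fd_profile 1 a (r\<^sup>2)))"
proof -
  have "integrable lborel (\<lambda>r. R\<^sup>2 * (indicator {0..} r * (r ^ 2 * fd_profile 1 a (r\<^sup>2)))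
       - indicator {0..} r * (r ^ 4 * fd_profile 1 a (r\<^sup>2)))"
    by (intro Bochner_Integration.integrable_diff integrable_mult_right integrable_halfline_fd) auto
  then show ?thesis
    by (rule back_subst[of "integrable lborel"]) (simp add: fun_eq_iff algebra_simps power_numeral_reduce)
qed

text \<open>
  The antiderivative of \<open>- fd_profile 1 a\<close> that vanishes at infinity. Its value at \<open>0\<close> is the
  quantity \<open>ln (1 + exp a)\<close> that has to be bounded.
\<close>
definition fd_pressure :: "real \<Rightarrow> real \<Rightarrow> real" where
  "fd_pressure a x = ln (1 + exp (a - x))"

lemma fd_pressure_pos: "0 < fd_pressure a x"
  by (simp add: fd_pressure_def ln_gt_zero)

lemma fd_pressure_le: "fd_pressure a x \<le> exp a * exp (- x)"
  using ln_add_one_self_le_self[of "exp (a - x)"] by (simp add: fd_pressure_def exp_diff exp_minus field_simps)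

lemma has_derivative_fd_pressure [derivative_intros]:
  assumes "(p has_real_derivative p') (at x)"
  shows "((\<lambda>x. fd_pressure a (p x)) has_real_derivative - fd_profile 1 a (p x) * p') (at x)"
  unfolding fd_pressure_def fd_profile_def
  by (rule derivative_eq_intros assms refl | simp add: add_pos_pos)+ 

lemma measurable_fd_pressure [measurable]:
  "fd_pressure a \<in> borel_measurable borel"
  unfolding fd_pressure_def by measurable

lemma integrable_halfline_fd_pressure:
  shows "integrable lborel (\<lambda>r. indicator {0..} r * (r ^ k * fd_pressure a (r\<^sup>2)))"
proof (rule Bochner_Integration.integrable_bound)
  show "integrable lborel (\<lambda>r. exp a * (indicator {0..} r * (r ^ k * exp (- r\<^sup>2))))"
    by (intro integrable_mult_right integrable_halfline_gaussian)
  show "AE r in lborel. norm (indicator {0..} r * (r ^ k * fd_pressure a (r\<^sup>2)))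
      \<le> norm (exp a * (indicator {0..} r * (r ^ k * exp (- r\<^sup>2))))"
  proof (rule AE_I2)
    fix r :: real
    have "\<bar>r ^ k\<bar> * fd_pressure a (r\<^sup>2) \<le> \<bar>r ^ k\<bar> * (exp a * exp (- r\<^sup>2))"
      using fd_pressure_le[of a "r\<^sup>2"] by (intro mult_left_mono) auto
    then show "norm (indicator {0..} r * (r ^ k * fd_pressure a (r\<^sup>2)))
      \<le> norm (exp a * (indicator {0..} r * (r ^ k * exp (- r\<^sup>2))))"
      using fd_pressure_pos[of a "r\<^sup>2"]
      by (auto simp: abs_mult ac_simps split: split_indicator)
  qed
qed measurable

lemma integrable_pressure_test:
  "integrable lborel (\<lambda>r. indicator {0..} r * ((R\<^sup>2 - 3 * r\<^sup>2) * fd_pressure a (r\<^sup>2)))"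
proof -
  have "integrable lborel (\<lambda>r. R\<^sup>2 * (indicator {0..} r * (r ^ 0 * fd_pressure a (r\<^sup>2)))
       - 3 * (indicator {0..} r * (r ^ 2 * fd_pressure a (r\<^sup>2))))"
    by (intro Bochner_Integration.integrable_diff integrable_mult_right integrable_halfline_fd_pressure)
  then show ?thesis
    by (rule back_subst[of "integrable lborel"]) (simp add: fun_eq_iff algebra_simps)
qed

text \<open>
  Integration by parts trades the profile for its antiderivative, whose value at
  the origin is exactly the quantity \<open>ln (1 + exp a)\<close> of the final estimate.
\<close>
lemma ball_test_by_parts:
  "ball_test a R = (LINT r|lborel. indicator {0..} r * ((R\<^sup>2 - 3 * r\<^sup>2) * fd_pressure a (r\<^sup>2))) / 2"
proof -
  define f where "f r = (R\<^sup>2 - 3 * r\<^sup>2) * fd_pressure a (r\<^sup>2) - 2 * (r\<^sup>2 * (R\<^sup>2 - r\<^sup>2) * fd_profile 1 a (r\<^sup>2))" for r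
  define F where "F r = r * (R\<^sup>2 - r\<^sup>2) * fd_pressure a (r\<^sup>2)" for r
  have split: "indicator {0..} r * f r = indicator {0..} r * ((R\<^sup>2 - 3 * r\<^sup>2) * fd_pressure a (r\<^sup>2))
      - 2 * (indicator {0..} r * (r\<^sup>2 * (R\<^sup>2 - r\<^sup>2) * fd_profile 1 a (r\<^sup>2)))" for r
    by (simp add: f_def algebra_simps)
  have "(LINT r|lborel. indicator {0..} r * f r) = 0 - F 0"
  proof (rule integral_halfline_FTC)
    show "(F has_real_derivative f r) (at r)" for r
      unfolding F_def f_def
      by (rule derivative_eq_intros refl | simp)+ (simp add: algebra_simps power2_eq_square power3_eq_cube)
    have "continuous_on UNIV (\<lambda>r. fd_pressure a (r\<^sup>2))"
      by (intro continuous_at_imp_continuous_on ballI DERIV_isCont) 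
        (rule derivative_eq_intros refl | simp)+
    then show "continuous_on UNIV f"
      unfolding f_def by (intro continuous_intros) auto
    show "integrable lborel (\<lambda>r. indicator {0..} r * f r)"
      unfolding split
      by (intro Bochner_Integration.integrable_diff integrable_mult_right integrable_pressure_test integrable_ball_test)
    have "((\<lambda>r. exp a * (R\<^sup>2 * (r ^ 1 * exp (- r\<^sup>2)) + r ^ 3 * exp (- r\<^sup>2))) \<longlongrightarrow> exp a * (R\<^sup>2 * 0 + 0)) at_top"
      by (intro tendsto_intros tendsto_power_gaussian_at_top)
    moreover have "\<forall>\<^sub>F r in at_top. norm (F r) \<le> exp a * (R\<^sup>2 * (r ^ 1 * exp (- r\<^sup>2)) + r ^ 3 * exp (- r\<^sup>2))"
      using eventually_ge_at_top[of 0]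
    proof eventually_elim
      case (elim r)
      have "norm (F r) = r * \<bar>R\<^sup>2 - r\<^sup>2\<bar> * fd_pressure a (r\<^sup>2)"
        using elim fd_pressure_pos[of a "r\<^sup>2"] by (simp add: F_def abs_mult)
      also have "\<dots> \<le> r * (R\<^sup>2 + r\<^sup>2) * (exp a * exp (- r\<^sup>2))"
        using elim fd_pressure_pos[of a "r\<^sup>2"] fd_pressure_le[of a "r\<^sup>2"] abs_triangle_ineq4[of "R\<^sup>2" "r\<^sup>2"]
        by (intro mult_mono) auto
      finally show ?case by (simp add: algebra_simps power2_eq_square power3_eq_cube)
    qed
    ultimately show "(F \<longlongrightarrow> 0) at_top"
      by (intro Lim_null_comparison[of F]) auto
  qed
  then have "(LINT r|lborel. indicator {0..} r * ((R\<^sup>2 - 3 * r\<^sup>2) * fd_pressure a (r\<^sup>2))) - 2 * ball_test a R = 0"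
    unfolding split ball_test_def
    by (subst (asm) Bochner_Integration.integral_diff)
      (auto intro!: integrable_pressure_test integrable_ball_test integrable_mult_right simp: F_def)
  then show ?thesis by simp
qed

text \<open>
  With \<open>G\<close> the pressure and \<open>m = - G'\<close> the profile one has \<open>m' = - m (1 - m)\<close>, and the sign of
  \<open>(ln G)''\<close> is that of \<open>(1 - m) G - m\<close>, which is nonpositive since \<open>1 - m = m exp (x - a)\<close> and
  \<open>ln (1 + y) \<le> y\<close>.
\<close>
lemma concave_ln_fd_pressure: "concave_on UNIV (\<lambda>x. ln (fd_pressure a x))"
proof (rule f''_le0_imp_concave)
  define m where "m x = fd_profile 1 a x" for x
  define G where "G x = fd_pressure a x" for x
  have G: "0 < G x" for x by (simp add: G_def fd_pressure_pos)
  have dG [derivative_intros]: "(G has_real_derivative - m x) (at x)" for x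
    using has_derivative_fd_pressure[OF DERIV_ident, of a x] by (simp add: G_def[abs_def] m_def)
  have dm [derivative_intros]: "(m has_real_derivative - m x * (1 - m x)) (at x)" for x
    unfolding m_def fd_profile_def
    by (rule derivative_eq_intros refl | simp add: add_pos_pos less_imp_neq[symmetric])+
      (simp add: divide_simps add_pos_pos less_imp_neq[symmetric], simp add: algebra_simps power2_eq_square)
  show "((\<lambda>x. ln (fd_pressure a x)) has_real_derivative - m x / G x) (at x)" for x
    using DERIV_ln_divide[OF G] G[of x] unfolding G_def[symmetric]
    by (auto intro!: derivative_eq_intros)
  show "((\<lambda>x. - m x / G x) has_real_derivative (m x * (1 - m x) * G x - m x * m x) / (G x * G x)) (at x)" for x
    by (rule derivative_eq_intros refl | simp add: less_imp_neq[OF G, symmetric])+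
  fix x
  have "(1 - m x) * G x \<le> m x"
  proof -
    have "G x \<le> exp (a - x)" using fd_pressure_le[of a x] by (simp add: G_def exp_diff exp_minus field_simps)
    moreover have "1 - m x = 1 / (1 + exp (a - x))" "m x = exp (a - x) / (1 + exp (a - x))"
      using fd_denom_pos[of 1 "a - x"] by (simp_all add: m_def fd_profile_def divide_simps)
    ultimately show ?thesis by (simp add: divide_right_mono add_pos_pos)
  qed
  moreover have "0 < m x" by (simp add: m_def fd_profile_pos)
  ultimately have "m x * ((1 - m x) * G x) \<le> m x * m x" by (intro mult_left_mono) auto
  then show "(m x * (1 - m x) * G x - m x * m x) / (G x * G x) \<le> 0"
    using G[of x] by (simp add: divide_le_0_iff mult.assoc)
qed simp

section \<open>A second-moment bound for Fermi-Dirac profiles\<close>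

text \<open>
  A concave function lies above a chord between its ends and below it further out. The two halves are
  what makes the sign-changing weight in \<open>ball_test_ge_chord\<close> harmless.
\<close>
lemma concave_on_real_chord:
  fixes \<phi> :: "real \<Rightarrow> real"
  assumes conc: "concave_on UNIV \<phi>" and "0 < x\<^sub>0" "0 \<le> x"
  shows "x \<le> x\<^sub>0 \<Longrightarrow> \<phi> 0 + x / x\<^sub>0 * (\<phi> x\<^sub>0 - \<phi> 0) \<le> \<phi> x"
    and "x\<^sub>0 \<le> x \<Longrightarrow> \<phi> x \<le> \<phi> 0 + x / x\<^sub>0 * (\<phi> x\<^sub>0 - \<phi> 0)"
proof -
  have conc': "(1 - t) * \<phi> 0 + t * \<phi> z \<le> \<phi> (t * z)" if "0 \<le> t" "t \<le> 1" for t z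
    using concave_onD[OF conc that, of 0 z] by simp
  show "\<phi> 0 + x / x\<^sub>0 * (\<phi> x\<^sub>0 - \<phi> 0) \<le> \<phi> x" if "x \<le> x\<^sub>0"
    using conc'[of "x / x\<^sub>0" x\<^sub>0] that assms by (simp add: algebra_simps)
  show "\<phi> x \<le> \<phi> 0 + x / x\<^sub>0 * (\<phi> x\<^sub>0 - \<phi> 0)" if "x\<^sub>0 \<le> x"
  proof -
    have "(1 - x\<^sub>0 / x) * \<phi> 0 + x\<^sub>0 / x * \<phi> x \<le> \<phi> x\<^sub>0"
      using conc'[of "x\<^sub>0 / x" x] that assms by simp
    then have "x / x\<^sub>0 * ((1 - x\<^sub>0 / x) * \<phi> 0 + x\<^sub>0 / x * \<phi> x) \<le> x / x\<^sub>0 * \<phi> x\<^sub>0"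
      using assms by (intro mult_left_mono) auto
    moreover have "x / x\<^sub>0 * ((1 - x\<^sub>0 / x) * \<phi> 0 + x\<^sub>0 / x * \<phi> x) = x / x\<^sub>0 * \<phi> 0 - \<phi> 0 + \<phi> x"
      using assms that by (simp add: field_simps)
    ultimately show ?thesis by (simp add: algebra_simps)
  qed
qed

text \<open>
  Let \<open>L * exp (- l * x)\<close> agree with the pressure at \<open>0\<close> and at \<open>x\<^sub>0\<close>. By log-concavity the pressure is
  above this function before \<open>x\<^sub>0\<close> and below it afterwards. With \<open>R\<^sup>2 = 3 * x\<^sub>0\<close> the weight
  \<open>R\<^sup>2 - 3 * r\<^sup>2\<close> changes sign at the same place, so the replacement by a Gaussian can only decrease the
  integral.
\<close>
lemma ball_test_ge_chord:
  assumes x0: "0 < x\<^sub>0" and lt: "fd_pressure a x\<^sub>0 < fd_pressure a 0"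
    and l: "l = ln (fd_pressure a 0 / fd_pressure a x\<^sub>0) / x\<^sub>0"
  shows "fd_pressure a 0 * (sqrt pi / 2 / sqrt l) * (3 * x\<^sub>0 - 3 / (2 * l)) / 2 \<le> ball_test a (sqrt (3 * x\<^sub>0))"
proof -
  define L where "L = fd_pressure a 0"
  have L: "0 < L" "0 < fd_pressure a x\<^sub>0" by (simp_all add: L_def fd_pressure_pos)
  have lpos: "0 < l" using lt L x0 by (simp add: l L_def)
  have chord: "ln L + x / x\<^sub>0 * (ln (fd_pressure a x\<^sub>0) - ln L) = ln (L * exp (- (l * x)))" for x
    using L x0 by (simp add: l L_def[symmetric] ln_mult ln_div field_simps)
  have pointwise: "(3 * x\<^sub>0 - 3 * x) * (L * exp (- (l * x))) \<le> (3 * x\<^sub>0 - 3 * x) * fd_pressure a x" if "0 \<le> x" for x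
  proof (cases "x \<le> x\<^sub>0")
    case True
    have "ln (L * exp (- (l * x))) \<le> ln (fd_pressure a x)"
      using concave_on_real_chord(1)[OF concave_ln_fd_pressure[of a] x0 that True] chord by (simp add: L_def)
    then have "L * exp (- (l * x)) \<le> fd_pressure a x"
      using L fd_pressure_pos[of a x] by (subst (asm) ln_le_cancel_iff) auto
    then show ?thesis using True by (intro mult_left_mono) auto
  next
    case False
    then have "ln (fd_pressure a x) \<le> ln (L * exp (- (l * x)))"
      using concave_on_real_chord(2)[OF concave_ln_fd_pressure[of a] x0 that] chord by (simp add: L_def)
    then have "fd_pressure a x \<le> L * exp (- (l * x))"
      using L fd_pressure_pos[of a x] by (subst (asm) ln_le_cancel_iff) auto
    then show ?thesis using False by (intro mult_left_mono_neg) auto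
  qed
  have "has_bochner_integral lborel
      (\<lambda>r. L * (3 * x\<^sub>0 * (indicator {0..} r * exp (- (l * r\<^sup>2))) - 3 * (indicator {0..} r * (r\<^sup>2 * exp (- (l * r\<^sup>2))))))
      (L * (3 * x\<^sub>0 * (sqrt pi / 2 / sqrt l) - 3 * (sqrt pi / 4 / (l * sqrt l))))"
    by (intro has_bochner_integral_mult_right has_bochner_integral_diff has_bochner_integral_halfline_gaussian lpos)
  then have G: "has_bochner_integral lborel
      (\<lambda>r. indicator {0..} r * ((3 * x\<^sub>0 - 3 * r\<^sup>2) * (L * exp (- (l * r\<^sup>2)))))
      (L * (3 * x\<^sub>0 * (sqrt pi / 2 / sqrt l) - 3 * (sqrt pi / 4 / (l * sqrt l))))"
    by (rule back_subst[of "\<lambda>f. has_bochner_integral lborel f _"]) (simp add: fun_eq_iff algebra_simps)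
  have "(LINT r|lborel. indicator {0..} r * ((3 * x\<^sub>0 - 3 * r\<^sup>2) * (L * exp (- (l * r\<^sup>2)))))
     \<le> (LINT r|lborel. indicator {0..} r * (((sqrt (3 * x\<^sub>0))\<^sup>2 - 3 * r\<^sup>2) * fd_pressure a (r\<^sup>2)))"
    using pointwise x0
    by (intro integral_mono integrable.intros[OF G] integrable_pressure_test)
      (auto split: split_indicator)
  then have "L * (3 * x\<^sub>0 * (sqrt pi / 2 / sqrt l) - 3 * (sqrt pi / 4 / (l * sqrt l))) / 2 \<le> ball_test a (sqrt (3 * x\<^sub>0))"
    using has_bochner_integral_integral_eq[OF G] by (simp add: ball_test_by_parts)
  also have "L * (3 * x\<^sub>0 * (sqrt pi / 2 / sqrt l) - 3 * (sqrt pi / 4 / (l * sqrt l))) / 2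
      = L * (sqrt pi / 2 / sqrt l) * (3 * x\<^sub>0 - 3 / (2 * l)) / 2"
    using lpos by (simp add: field_simps)
  finally show ?thesis by (simp add: L_def)
qed

lemma ln_leI: "0 < x \<Longrightarrow> x \<le> exp y \<Longrightarrow> ln x \<le> (y::real)"
  by (metis ln_exp ln_le_cancel_iff exp_gt_zero)

lemma ln_3_bounds: "1 \<le> ln (3::real)" "ln (3::real) \<le> 6 / 5"
proof -
  show "1 \<le> ln (3::real)" using exp_le by (subst ln_ge_iff) auto
  have "(1 + 3/5 + (3/5)\<^sup>2 / 2)\<^sup>2 \<le> (exp (3/5 :: real))\<^sup>2"
    by (intro power_mono exp_lower_Taylor_quadratic) auto
  also have "\<dots> = exp (6/5)" by (simp flip: exp_double)
  finally have "3 \<le> exp (6/5::real)" by (simp add: power2_eq_square)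
  then show "ln (3::real) \<le> 6 / 5" by (intro ln_leI) auto
qed

text \<open>
  The chord is taken up to the point where the pressure has dropped to a third of \<open>L\<close>. With
  \<open>y = exp (L / 3)\<close>, so that \<open>y ^ 3 = 1 + exp a\<close>, this point is explicit,
  \<open>x\<^sub>0 = ln (1 + y + y\<^sup>2)\<close>, and what remains is a numerical inequality with some room. The argument
  loses a constant factor for large \<open>a\<close>, where the profile is a plateau rather than a Gaussian.
\<close>
lemma ball_test_ge_moderate:
  assumes "exp a \<le> 63"
  shows "\<exists>R>0. ln (1 + exp a) / (8 + ln (1 + exp a)) * (2 / 15 * R ^ 5) \<le> ball_test a R"
proof -
  define L where "L = ln (1 + exp a)"
  define y where "y = exp (L / 3)"
  define x\<^sub>0 where "x\<^sub>0 = ln (1 + y + y\<^sup>2)"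
  define l where "l = ln 3 / x\<^sub>0"
  have Lpos: "0 < L" by (simp add: L_def ln_gt_zero)
  have y1: "1 < y" using Lpos by (simp add: y_def)
  have "y ^ 3 = exp L" by (simp add: y_def flip: exp_of_nat_mult)
  also have "\<dots> = 1 + exp a" by (simp add: L_def add_pos_pos)
  finally have y3: "y ^ 3 = 1 + exp a" .
  have x0: "0 < x\<^sub>0" unfolding x\<^sub>0_def using y1 by (intro ln_gt_zero) (auto simp: add_pos_pos)
  have L0: "fd_pressure a 0 = L" by (simp add: fd_pressure_def L_def)
  have "exp (a - x\<^sub>0) = (y ^ 3 - 1) / (1 + y + y\<^sup>2)"
    using y1 y3 by (simp add: x\<^sub>0_def exp_diff add_pos_pos)
  also have "\<dots> = y - 1"
    using y1 by (simp add: divide_simps add_pos_pos less_imp_neq[symmetric]) (simp add: algebra_simps power2_eq_square power3_eq_cube)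
  finally have Lx: "fd_pressure a x\<^sub>0 = L / 3"
    by (simp add: fd_pressure_def y_def)
  have lpos: "0 < l" using x0 by (simp add: l_def)
  have l3: "l * x\<^sub>0 = ln 3" using x0 by (simp add: l_def)

  have "y ^ 3 \<le> 4 ^ 3" using y3 assms by simp
  then have y4: "y \<le> 4" using power_le_imp_le_base[of y 2 4] y1 by (simp add: numeral_3_eq_3)
  \<comment> \<open>The linear bound \<open>1 + y + y\<^sup>2 \<le> 6 * y\<close> on this range makes \<open>x\<^sub>0\<close> at most affine in \<open>L\<close>, with slope \<open>1 / 3\<close>.\<close>
  have "(y - 4) * (y - 1) \<le> 0" using y4 y1 by (intro mult_nonpos_nonneg) auto
  then have "1 + y + y\<^sup>2 \<le> 6 * y" using y1 y4 by (simp add: algebra_simps power2_eq_square)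
  also have "\<dots> \<le> exp 2 * y"
  proof -
    have "(1 + 1 + 1\<^sup>2/2)\<^sup>2 \<le> (exp (1::real))\<^sup>2" by (intro power_mono exp_lower_Taylor_quadratic) auto
    also have "\<dots> = exp 2" by (simp flip: exp_double)
    finally have "6 \<le> exp (2::real)" by (simp add: power2_eq_square)
    then show ?thesis using y1 by (intro mult_right_mono) auto
  qed
  also have "\<dots> = exp (2 + L / 3)" by (simp add: y_def exp_add)
  finally have x0_le: "x\<^sub>0 \<le> 2 + L / 3"
    unfolding x\<^sub>0_def using y1 by (intro ln_leI) (auto simp: add_pos_pos)
  have "exp L \<le> 2 ^ 6" using y3 \<open>y ^ 3 = exp L\<close> assms by simp
  then have "L \<le> ln (2 ^ 6)" by (subst ln_ge_iff) auto
  also have "\<dots> = 6 * ln 2" by (subst ln_realpow) simp_all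
  also have "\<dots> \<le> 21 / 5" using ln2_le_25_over_36 by simp
  finally have L5: "L \<le> 21 / 5" .

  \<comment> \<open>The claim after division by \<open>L * x\<^sub>0 / ((8 + L) * sqrt l)\<close>, the factor common to both sides.\<close>
  have main: "6 / 5 * sqrt (3 * ln 3) * x\<^sub>0 \<le> 3 / 4 * sqrt pi * (1 - 1 / (2 * ln 3)) * (8 + L)"
  proof -
    have "sqrt (3 * ln 3) \<le> 19 / 10"
      using ln_3_bounds by (intro real_le_lsqrt) (auto simp: power2_eq_square)
    then have "6 / 5 * sqrt (3 * ln 3) * x\<^sub>0 \<le> 6 / 5 * (19 / 10) * (2 + L / 3)"
      using x0_le x0 ln_3_bounds by (intro mult_mono) auto
    also have "\<dots> \<le> 3 / 4 * (17 / 10) * (1 / 2) * (8 + L)"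
      using L5 Lpos by (simp add: field_simps)
    also have "\<dots> \<le> 3 / 4 * sqrt pi * (1 - 1 / (2 * ln 3)) * (8 + L)"
    proof -
      have "17 / 10 \<le> sqrt pi" using pi_gt3 by (intro real_le_rsqrt) (simp add: power2_eq_square)
      moreover have "1 / 2 \<le> 1 - 1 / (2 * ln (3::real))"
        using ln_3_bounds by (simp add: field_simps)
      ultimately have "17 / 10 * (1 / 2) \<le> sqrt pi * (1 - 1 / (2 * ln 3))"
        by (rule mult_mono) simp_all
      then have "3 / 4 * (8 + L) * (17 / 10 * (1 / 2)) \<le> 3 / 4 * (8 + L) * (sqrt pi * (1 - 1 / (2 * ln 3)))"
        by (rule mult_left_mono) (use Lpos in simp)
      then show ?thesis by (simp only: mult_ac)
    qed
    finally show ?thesis .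
  qed
  define R where "R = sqrt (3 * x\<^sub>0)"
  have R: "0 < R" "R\<^sup>2 = 3 * x\<^sub>0" using x0 by (simp_all add: R_def)
  have Rl: "R * sqrt l = sqrt (3 * ln 3)"
    unfolding R_def using l3 by (simp add: real_sqrt_mult[symmetric] mult.commute mult.left_commute)
  have "L / (8 + L) * (2 / 15 * R ^ 5) = L * x\<^sub>0 / ((8 + L) * sqrt l) * (6 / 5 * (R * sqrt l) * x\<^sub>0)"
  proof -
    have "R ^ 5 = (R\<^sup>2)\<^sup>2 * R" by (simp add: power_numeral_reduce)
    then have "R ^ 5 = 9 * x\<^sub>0\<^sup>2 * R" by (simp add: R(2) power_mult_distrib)
    moreover have "L / M * (2 / 15 * (9 * x\<^sub>0\<^sup>2 * R)) = L * x\<^sub>0 / (M * S) * (6 / 5 * (R * S) * x\<^sub>0)"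
      if "M \<noteq> 0" "S \<noteq> 0" for M S :: real
      using that by (simp add: field_simps power2_eq_square)
    ultimately show ?thesis using lpos Lpos by (simp add: power2_eq_square)
  qed
  also have "\<dots> \<le> L * x\<^sub>0 / ((8 + L) * sqrt l) * (3 / 4 * sqrt pi * (1 - 1 / (2 * ln 3)) * (8 + L))"
    unfolding Rl using main Lpos x0 lpos by (intro mult_left_mono) auto
  also have "\<dots> = L * (sqrt pi / 2 / sqrt l) * (3 * x\<^sub>0 - 3 / (2 * l)) / 2"
  proof -
    have "L * x\<^sub>0 / (M * S) * (3 / 4 * sqrt pi * (1 - 1 / (2 * k)) * M) = L * (sqrt pi / 2 / S) * (3 * x\<^sub>0 - 3 / (2 * (k / x\<^sub>0))) / 2"
      if "M \<noteq> 0" "S \<noteq> 0" "k \<noteq> 0" for M S k :: real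
      using that x0 by (simp add: field_simps)
    from this[of "8 + L" "sqrt l" "ln 3"] show ?thesis
      using Lpos lpos x0 ln_3_bounds(1) by (simp add: l_def)
  qed
  also have "\<dots> \<le> ball_test a R"
    unfolding R_def L0[symmetric]
  proof (rule ball_test_ge_chord[OF x0])
    show "fd_pressure a x\<^sub>0 < fd_pressure a 0" using Lpos by (simp add: L0 Lx)
    show "l = ln (fd_pressure a 0 / fd_pressure a x\<^sub>0) / x\<^sub>0" using Lpos by (simp add: L0 Lx l_def)
  qed
  finally show ?thesis using R(1) unfolding L_def by blast
qed

text \<open>
  For large \<open>a\<close> the profile is close to the indicator function of the ball of radius \<open>sqrt a\<close>, which
  accounts for the first term. Inside, the deficit is at most \<open>exp (r\<^sup>2 - a)\<close>; outside, the profile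
  is at most \<open>exp (a - r\<^sup>2)\<close>. Replacing one factor \<open>r\<close> by \<open>sqrt a\<close> inside, and \<open>r\<^sup>2\<close> by
  \<open>r * (r\<^sup>2 + a) / (2 * sqrt a)\<close> outside, turns both error integrands into exact derivatives.
\<close>
lemma ball_test_ge_degenerate:
  assumes a: "4 \<le> a"
  shows "2 / 15 * (a\<^sup>2 * sqrt a) - sqrt a / 2 - (a + 1) / (2 * sqrt a) \<le> ball_test a (sqrt a)"
proof -
  define s where "s = sqrt a"
  have s: "0 < s" "s\<^sup>2 = a" "s * s = a" using a by (simp_all add: s_def)
  have "s ^ 4 = (s\<^sup>2)\<^sup>2" by simp
  then have s4: "s ^ 4 = a\<^sup>2" using s by simp
  have s35: "s ^ 3 = a * s" "s ^ 5 = a\<^sup>2 * s"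
    using s(2) s4 power_add[of s 2 1] power_add[of s 4 1] by simp_all
  \<comment> \<open>\<open>p\<close> and \<open>- q / (2 * s)\<close> bound the integrand from below inside and outside the ball of radius \<open>s\<close>; \<open>P\<close> and \<open>Q\<close> are their antiderivatives.\<close>
  define p where "p r = r\<^sup>2 * (a - r\<^sup>2) - s * (r * (a - r\<^sup>2) * exp (r\<^sup>2 - a))" for r
  define q where "q r = r * (r\<^sup>2 - a) * (r\<^sup>2 + a) * exp (a - r\<^sup>2)" for r
  define P where "P r = a * r ^ 3 / 3 - r ^ 5 / 5 - s * ((a - r\<^sup>2 + 1) * exp (r\<^sup>2 - a) / 2)" for r
  define Q where "Q r = - ((r ^ 4 + 2 * r\<^sup>2 + 2 - a\<^sup>2) * exp (a - r\<^sup>2)) / 2" for r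
  have intp: "has_bochner_integral lborel (\<lambda>r. p r * indicator {0..s} r) (P s - P 0)"
  proof (rule has_bochner_integral_FTC_Icc_real)
    show "(P has_real_derivative p r) (at r)" for r
      unfolding P_def p_def
      by (rule derivative_eq_intros refl | simp)+ (simp add: field_simps power_numeral_reduce)
    show "isCont p r" for r unfolding p_def by (intro continuous_intros)
  qed (use s in simp)
  have "has_bochner_integral lborel (\<lambda>r. q r * indicator {s..} r) (0 - Q s)"
  proof -
    have qb [measurable]: "q \<in> borel_measurable borel" unfolding q_def by measurable
    have q0: "0 \<le> q r" if "s \<le> r" for r
      using that s power_mono[OF that, of 2] a by (auto simp: q_def intro!: mult_nonneg_nonneg)
    have "(\<integral>\<^sup>+r. ennreal (q r) * indicator {s..} r \<partial>lborel) = ennreal (0 - Q s)"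
    proof (rule nn_integral_FTC_atLeast)
      show "(Q has_real_derivative q r) (at r)" for r
        unfolding Q_def q_def
        by (rule derivative_eq_intros refl | simp)+ (simp add: algebra_simps power_numeral_reduce)
      have "Q = (\<lambda>r. - exp a / 2 * (r ^ 4 * exp (- r\<^sup>2) + 2 * (r ^ 2 * exp (- r\<^sup>2)) + (2 - a\<^sup>2) * (r ^ 0 * exp (- r\<^sup>2))))"
        by (simp add: fun_eq_iff Q_def exp_diff exp_minus field_simps)
      moreover have "((\<lambda>r. - exp a / 2 * (r ^ 4 * exp (- r\<^sup>2) + 2 * (r ^ 2 * exp (- r\<^sup>2)) + (2 - a\<^sup>2) * (r ^ 0 * exp (- r\<^sup>2))))
          \<longlongrightarrow> - exp a / 2 * (0 + 2 * 0 + (2 - a\<^sup>2) * 0)) at_top"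
        by (intro tendsto_intros tendsto_power_gaussian_at_top) auto
      ultimately have "(Q \<longlongrightarrow> - exp a / 2 * (0 + 2 * 0 + (2 - a\<^sup>2) * 0)) at_top" by (simp only:)
      then show "(Q \<longlongrightarrow> 0) at_top" by simp
      show "0 \<le> q r" if "s \<le> r" for r using that by (rule q0)
    qed (rule qb)
    moreover have "(\<integral>\<^sup>+r. ennreal (q r * indicator {s..} r) \<partial>lborel) = (\<integral>\<^sup>+r. ennreal (q r) * indicator {s..} r \<partial>lborel)"
      by (intro nn_integral_cong) (simp split: split_indicator)
    moreover have "0 \<le> 0 - Q s"
      using s a s4 by (simp add: Q_def)
    ultimately show ?thesis
    proof (intro has_bochner_integral_nn_integral)
      show "AE r in lborel. 0 \<le> q r * indicator {s..} r"
        by (intro AE_I2) (simp add: q0 split: split_indicator)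
    qed simp_all
  qed
  then have intq: "has_bochner_integral lborel (\<lambda>r. 1 / (2 * s) * (q r * indicator {s..} r)) (1 / (2 * s) * (0 - Q s))"
    by (rule has_bochner_integral_mult_right)
  have m: "exp (a - x) \<ge> fd_profile 1 a x" "1 - exp (x - a) \<le> fd_profile 1 a x" for x
  proof -
    show "fd_profile 1 a x \<le> exp (a - x)"
      using fd_profile_le_exp[of 1 a x] by (simp add: exp_diff exp_minus divide_inverse)
    have "(1 - exp (x - a)) * (1 + exp (a - x)) = exp (a - x) - exp (x - a)"
      by (simp add: algebra_simps flip: exp_add)
    then show "1 - exp (x - a) \<le> fd_profile 1 a x"
      by (simp add: fd_profile_def le_divide_eq add_pos_pos)
  qed
  have pointwise: "p r * indicator {0..s} r - 1 / (2 * s) * (q r * indicator {s..} r)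
      \<le> indicator {0..} r * (r\<^sup>2 * (s\<^sup>2 - r\<^sup>2) * fd_profile 1 a (r\<^sup>2))" for r
  proof -
    consider "r < 0" | "0 \<le> r" "r < s" | "r = s" | "s < r" by linarith
    then show ?thesis
    proof cases
      case 1
      then show ?thesis using s by simp
    next
      case 2
      then have "r\<^sup>2 < a" using s power_strict_mono[of r s 2] by simp
      then have "r\<^sup>2 * (a - r\<^sup>2) * (1 - exp (r\<^sup>2 - a)) \<le> r\<^sup>2 * (a - r\<^sup>2) * fd_profile 1 a (r\<^sup>2)"
        using m by (intro mult_left_mono) auto
      moreover have "r * (r * (a - r\<^sup>2) * exp (r\<^sup>2 - a)) \<le> s * (r * (a - r\<^sup>2) * exp (r\<^sup>2 - a))"
        using 2 \<open>r\<^sup>2 < a\<close> by (intro mult_right_mono) auto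
      ultimately have "p r \<le> r\<^sup>2 * (a - r\<^sup>2) * fd_profile 1 a (r\<^sup>2)"
        unfolding p_def by (simp add: algebra_simps power2_eq_square)
      then show ?thesis using 2 s by simp
    next
      case 3
      then show ?thesis using s by (simp add: p_def q_def)
    next
      case 4
      then have r2: "a < r\<^sup>2" using s power_strict_mono[of s r 2] by simp
      have "2 * s * r \<le> r\<^sup>2 + a" using sum_squares_bound[of s r] s by (simp add: mult.commute)
      then have "r\<^sup>2 \<le> r * (r\<^sup>2 + a) / (2 * s)"
        using 4 s mult_left_mono[of "2 * s * r" "r\<^sup>2 + a" r] by (simp add: field_simps power2_eq_square)
      then have "r\<^sup>2 * ((r\<^sup>2 - a) * fd_profile 1 a (r\<^sup>2)) \<le> r * (r\<^sup>2 + a) / (2 * s) * ((r\<^sup>2 - a) * exp (a - r\<^sup>2))"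
        using m r2 4 s a fd_profile_pos[of 1 a "r\<^sup>2"] by (intro mult_mono mult_nonneg_nonneg) auto
      then have "r\<^sup>2 * ((r\<^sup>2 - a) * fd_profile 1 a (r\<^sup>2)) \<le> 1 / (2 * s) * q r"
        by (simp add: q_def mult_ac)
      moreover have "r\<^sup>2 * (s\<^sup>2 - r\<^sup>2) * fd_profile 1 a (r\<^sup>2) = - (r\<^sup>2 * ((r\<^sup>2 - a) * fd_profile 1 a (r\<^sup>2)))"
        by (simp add: s(2) algebra_simps)
      ultimately show ?thesis using 4 s by simp
    qed
  qed
  have "(P s - P 0) - 1 / (2 * s) * (0 - Q s) \<le> ball_test a s"
    unfolding ball_test_def has_bochner_integral_integral_eq[OF has_bochner_integral_diff[OF intp intq], symmetric]
    by (intro integral_mono pointwise integrable_ball_test integrable.intros[OF has_bochner_integral_diff[OF intp intq]])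
  moreover have "P s = 2 / 15 * (a\<^sup>2 * s) - s / 2"
    using s(2) by (simp add: P_def s35 power2_eq_square)
  moreover have "P 0 \<le> 0" using s a by (simp add: P_def)
  moreover have "Q s = - (a + 1)" using s s4 by (simp add: Q_def field_simps)
  ultimately show ?thesis unfolding s_def[symmetric] by (simp add: add.commute)
qed

lemma ball_test_ge_large:
  assumes a: "4 \<le> a"
  shows "ln (1 + exp a) / (8 + ln (1 + exp a)) * (2 / 15 * sqrt a ^ 5) \<le> ball_test a (sqrt a)"
proof -
  define s where "s = sqrt a"
  define L where "L = ln (1 + exp a)"
  have s: "0 < s" "s\<^sup>2 = a" "s * s = a" using a by (simp_all add: s_def)
  have "s ^ 5 = (s\<^sup>2)\<^sup>2 * s" by (simp add: power_numeral_reduce)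
  then have s5: "s ^ 5 = a\<^sup>2 * s" using s by simp
  have Lpos: "0 < L" by (simp add: L_def ln_gt_zero)
  \<comment> \<open>The relative error from \<open>ball_test_ge_degenerate\<close> is \<open>(15 / 2) * (1 + 1 / (2 * a)) / a\<^sup>2\<close>, to be compared with \<open>8 / (8 + L)\<close> and \<open>L \<le> a + 1\<close>; the comparison holds from \<open>a = 4\<close> on.\<close>
  have "1 + exp a \<le> exp a * 2" using a by simp
  also have "\<dots> \<le> exp a * exp 1" using exp_ge_add_one_self[of 1] by (intro mult_left_mono) auto
  finally have "1 + exp a \<le> exp (a + 1)" by (simp add: exp_add)
  then have La: "L \<le> a + 1" by (auto simp: L_def add_pos_pos intro: ln_leI)
  have "15 * (2 * a + 1) * (8 + L) \<le> 15 * (2 * a + 1) * (9 + a)"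
    using La a by (intro mult_left_mono) auto
  also have "\<dots> \<le> 32 * a ^ 3"
  proof -
    define d where "d = a - 4"
    have "0 \<le> d" "a = 4 + d" using a by (simp_all add: d_def)
    then show ?thesis by (simp add: power_numeral_reduce algebra_simps add_nonneg_nonneg)
  qed
  finally have key: "15 * (2 * a + 1) * (8 + L) \<le> 32 * a ^ 3" .
  define K where "K = 8 + L"
  have K: "0 < K" using Lpos by (simp add: K_def)
  have "L / (8 + L) * (2 / 15 * s ^ 5) = 2 / 15 * (a\<^sup>2 * s) - 16 / 15 * (a\<^sup>2 * s) / (8 + L)"
    using Lpos by (simp add: s5 field_simps)
  also have "\<dots> \<le> 2 / 15 * (a\<^sup>2 * s) - s / 2 - (a + 1) / (2 * s)"
  proof -
    have "s / 2 + (a + 1) / (2 * s) = s * (2 * a + 1) / (2 * a)"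
    proof -
      have "s / 2 + (s * s + 1) / (2 * s) = s * (2 * (s * s) + 1) / (2 * (s * s))"
        using s(1) by (simp add: field_simps)
      then show ?thesis unfolding s(3) .
    qed
    also have "\<dots> = s / (30 * a * K) * (15 * (2 * a + 1) * K)"
      unfolding times_divide_eq_left
      by (subst frac_eq_eq) (use a K in \<open>simp_all add: algebra_simps\<close>)
    also have "\<dots> \<le> s / (30 * a * K) * (32 * a ^ 3)"
      using key s a K unfolding K_def[symmetric] by (intro mult_left_mono) auto
    also have "\<dots> = 16 / 15 * (a\<^sup>2 * s) / K"
      using a K by (simp add: field_simps power2_eq_square power3_eq_cube)
    finally show ?thesis by (simp add: K_def)
  qed
  also have "\<dots> \<le> ball_test a s" unfolding s_def by (rule ball_test_ge_degenerate[OF a])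
  finally show ?thesis by (simp add: L_def s_def)
qed

theorem ball_test_lower_bound:
  "\<exists>R>0. ln (1 + exp a) / (8 + ln (1 + exp a)) * (2 / 15 * R ^ 5) \<le> ball_test a R"
proof (cases "exp a \<le> 63")
  case True
  then show ?thesis by (rule ball_test_ge_moderate)
next
  case False
  have "exp (4::real) = exp 1 ^ 4" by (simp flip: exp_of_nat_mult)
  also have "\<dots> \<le> (272/100) ^ 4"
    using e_less_272 by (intro power_mono) auto
  also have "\<dots> \<le> 63" by (simp add: power_numeral_reduce)
  finally have "exp 4 < exp a" using False by linarith
  then have "4 \<le> a" by simp
  then show ?thesis using ball_test_ge_large[of a] by (intro exI[of _ "sqrt a"]) auto
qed

section \<open>Polar coordinates in three dimensions\<close>

lemma lborel_affine_integral:
  fixes w :: "'a::euclidean_space" and f :: "'a \<Rightarrow> 'b::{banach, second_countable_topology}"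
  assumes c: "c \<noteq> 0" and [measurable]: "f \<in> borel_measurable borel"
  shows "integrable lborel f \<longleftrightarrow> integrable lborel (\<lambda>v. f (w + c *\<^sub>R v))"
    and "(LINT v|lborel. f v) = \<bar>c\<bar> ^ DIM('a) *\<^sub>R (LINT v|lborel. f (w + c *\<^sub>R v))"
proof -
  have "integrable lborel f \<longleftrightarrow> integrable lborel (\<lambda>v. \<bar>c\<bar> ^ DIM('a) *\<^sub>R f (w + c *\<^sub>R v))"
    by (subst lborel_affine[OF c, of w]) (simp add: integrable_density integrable_distr_eq)
  also have "\<dots> \<longleftrightarrow> integrable lborel (\<lambda>v. f (w + c *\<^sub>R v))"
    using c integrable_scaleR_right[of "inverse (\<bar>c\<bar> ^ DIM('a))" lborel "\<lambda>v. \<bar>c\<bar> ^ DIM('a) *\<^sub>R f (w + c *\<^sub>R v)"]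
    by auto
  finally show "integrable lborel f \<longleftrightarrow> integrable lborel (\<lambda>v. f (w + c *\<^sub>R v))" .
  have "(LINT v|lborel. f v) = (LINT v|lborel. \<bar>c\<bar> ^ DIM('a) *\<^sub>R f (w + c *\<^sub>R v))"
    by (subst lborel_affine[OF c, of w]) (simp add: integral_density integral_distr)
  then show "(LINT v|lborel. f v) = \<bar>c\<bar> ^ DIM('a) *\<^sub>R (LINT v|lborel. f (w + c *\<^sub>R v))"
    by simp
qed

text \<open>
  Both measures give a half-line up to \<open>R\<close> the volume of the ball of radius \<open>R\<close>.
\<close>
lemma distr_norm_lborel:
  "distr lborel borel (norm :: real^3 \<Rightarrow> real) = density lborel (\<lambda>r. ennreal (indicator {0..} r * (4 * pi * r\<^sup>2)))"
  (is "?M = ?N")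
proof (rule measure_eqI_generator_eq[where E="range atMost" and \<Omega>=UNIV and A="\<lambda>i. {..real i}"])
  have M: "emeasure ?M {..R} = (if R < 0 then 0 else ennreal (4 / 3 * pi * R ^ 3))" for R
  proof -
    have "emeasure ?M {..R} = emeasure lborel (cball (0::real^3) R)"
      by (subst emeasure_distr) (auto intro!: arg_cong[where f="emeasure lborel"])
    also have "\<dots> = (if R < 0 then 0 else ennreal (4 / 3 * pi * R ^ 3))"
      by (simp add: emeasure_cball unit_ball_vol_3)
    finally show ?thesis .
  qed
  have N: "emeasure ?N {..R} = (if R < 0 then 0 else ennreal (4 / 3 * pi * R ^ 3))" for R
  proof -
    have "emeasure ?N {..R} = (\<integral>\<^sup>+r. ennreal (indicator {0..} r * (4 * pi * r\<^sup>2)) * indicator {..R} r \<partial>lborel)"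
      by (subst emeasure_density) auto
    also have "\<dots> = (\<integral>\<^sup>+r. ennreal (4 * pi * r\<^sup>2) * indicator {0..R} r \<partial>lborel)"
      by (intro nn_integral_cong) (auto split: split_indicator)
    also have "\<dots> = (if R < 0 then 0 else ennreal (4 / 3 * pi * R ^ 3))"
    proof (cases "R < 0")
      case False
      have "(\<integral>\<^sup>+r. ennreal (4 * pi * r\<^sup>2) * indicator {0..R} r \<partial>lborel) = ennreal (4 / 3 * pi * R ^ 3 - 4 / 3 * pi * 0 ^ 3)"
        using False by (intro nn_integral_FTC_Icc) (auto intro!: derivative_eq_intros)
      then show ?thesis using False by simp
    qed simp
    finally show ?thesis .
  qed
  show "emeasure ?M X = emeasure ?N X" if "X \<in> range atMost" for X
    using that M N by auto
  show "emeasure ?M {..real i} \<noteq> \<infinity>" for i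
    by (simp only: M) auto
  show "Int_stable (range (atMost :: real \<Rightarrow> _))" by (auto simp: Int_stable_def Int_atMost)
  show "sets ?M = sigma_sets UNIV (range atMost)" "sets ?N = sigma_sets UNIV (range atMost)"
    by (simp_all add: borel_eq_atMost)
  show "(\<Union>i. {..real i}) = UNIV" using real_arch_simple by auto
qed auto

lemma polar:
  fixes F :: "real \<Rightarrow> real"
  assumes [measurable]: "F \<in> borel_measurable borel"
  shows "integrable lborel (\<lambda>v::real^3. F (norm v)) \<longleftrightarrow> integrable lborel (\<lambda>r. indicator {0..} r * (r\<^sup>2 * F r))"
    and "(LINT v|lborel. F (norm (v::real^3))) = 4 * pi * (LINT r|lborel. indicator {0..} r * (r\<^sup>2 * F r))"
proof -
  have eq: "indicator {0..} r * (4 * pi * r\<^sup>2) * F r = 4 * pi * (indicator {0..} r * (r\<^sup>2 * F r))" for r :: real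
    by simp
  have "integrable lborel (\<lambda>v::real^3. F (norm v)) \<longleftrightarrow> integrable (distr lborel borel (norm :: real^3 \<Rightarrow> real)) F"
    by (rule integrable_distr_eq[symmetric]) auto
  also have "\<dots> \<longleftrightarrow> integrable lborel (\<lambda>r. indicator {0..} r * (4 * pi * r\<^sup>2) * F r)"
    unfolding distr_norm_lborel by (subst integrable_density) auto
  also have "\<dots> \<longleftrightarrow> integrable lborel (\<lambda>r. indicator {0..} r * (r\<^sup>2 * F r))"
    unfolding eq by (subst integrable_mult_left_iff) simp
  finally show "integrable lborel (\<lambda>v::real^3. F (norm v)) \<longleftrightarrow> integrable lborel (\<lambda>r. indicator {0..} r * (r\<^sup>2 * F r))" .
  have "(LINT v|lborel. F (norm (v::real^3))) = (LINT r|distr lborel borel (norm :: real^3 \<Rightarrow> real). F r)"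
    by (rule integral_distr[symmetric]) auto
  also have "\<dots> = (LINT r|lborel. indicator {0..} r * (4 * pi * r\<^sup>2) * F r)"
    unfolding distr_norm_lborel by (subst integral_density) auto
  also have "\<dots> = 4 * pi * (LINT r|lborel. indicator {0..} r * (r\<^sup>2 * F r))"
    unfolding eq by simp
  finally show "(LINT v|lborel. F (norm (v::real^3))) = 4 * pi * (LINT r|lborel. indicator {0..} r * (r\<^sup>2 * F r))" .
qed

section \<open>Moments and Fermi-Dirac distributions\<close>

lemma L12_integrable:
  assumes "f \<in> L12"
  shows "integrable lebesgue f"
    and "integrable lebesgue (\<lambda>v. f v *\<^sub>R v)"
    and "integrable lebesgue (\<lambda>v. f v * (norm v)\<^sup>2)"
proof -
  have [measurable]: "f \<in> borel_measurable lebesgue"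
    and int: "integrable lebesgue (\<lambda>v. \<bar>f v\<bar> * (1 + (norm v)\<^sup>2))"
    using assms by (auto simp: L12_def)
  have [measurable]: "(\<lambda>v. v) \<in> borel_measurable (lebesgue :: (real^3) measure)"
    by (intro measurable_completion) simp
  have le: "norm v \<le> 1 + (norm v)\<^sup>2" for v :: "real^3"
    using sum_squares_bound[of "norm v" 1] norm_ge_zero[of v] unfolding one_power2 by linarith
  show "integrable lebesgue f"
    by (rule Bochner_Integration.integrable_bound[OF int])
      (auto intro!: AE_I2 simp: abs_mult mult_left_le algebra_simps)
  show "integrable lebesgue (\<lambda>v. f v *\<^sub>R v)"
    by (rule Bochner_Integration.integrable_bound[OF int])
      (use le in \<open>auto intro!: AE_I2 mult_left_mono simp: abs_mult abs_of_nonneg\<close>)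
  show "integrable lebesgue (\<lambda>v. f v * (norm v)\<^sup>2)"
    by (rule Bochner_Integration.integrable_bound[OF int])
      (auto intro!: AE_I2 simp: abs_mult algebra_simps)
qed

lemma norm_diff_sq: "(norm (v - w))\<^sup>2 = (norm v)\<^sup>2 - 2 * (v \<bullet> w) + (norm w)\<^sup>2" for v w :: "'a::real_inner"
  by (simp add: power2_norm_eq_inner inner_commute algebra_simps)

lemma L12_quadratic:
  assumes "f \<in> L12"
  shows "integrable lebesgue (\<lambda>v. f v * (a + b * (norm (v - w))\<^sup>2))"
    and "(LINT v|lebesgue. f v * (a + b * (norm (v - w))\<^sup>2)) =
      (a + b * (norm w)\<^sup>2) * (LINT v|lebesgue. f v) - 2 * b * ((LINT v|lebesgue. f v *\<^sub>R v) \<bullet> w)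
      + b * (LINT v|lebesgue. f v * (norm v)\<^sup>2)"
proof -
  note I = L12_integrable[OF assms]
  have eq: "f v * (a + b * (norm (v - w))\<^sup>2) =
     (a + b * (norm w)\<^sup>2) * f v - 2 * b * ((f v *\<^sub>R v) \<bullet> w) + b * (f v * (norm v)\<^sup>2)" for v
    by (simp add: norm_diff_sq algebra_simps)
  have i1: "integrable lebesgue (\<lambda>v. (a + b * (norm w)\<^sup>2) * f v)" by (intro integrable_mult_right I)
  have i2: "integrable lebesgue (\<lambda>v. 2 * b * ((f v *\<^sub>R v) \<bullet> w))"
    by (intro integrable_mult_right integrable_inner_left I)
  have i3: "integrable lebesgue (\<lambda>v. b * (f v * (norm v)\<^sup>2))" by (intro integrable_mult_right I)
  show "integrable lebesgue (\<lambda>v. f v * (a + b * (norm (v - w))\<^sup>2))"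
    unfolding eq by (intro Bochner_Integration.integrable_add Bochner_Integration.integrable_diff i1 i2 i3)
  have inner: "(LINT v|lebesgue. (f v *\<^sub>R v) \<bullet> w) = (LINT v|lebesgue. f v *\<^sub>R v) \<bullet> w"
    by (rule integral_inner_left) (rule I)
  show "(LINT v|lebesgue. f v * (a + b * (norm (v - w))\<^sup>2)) =
      (a + b * (norm w)\<^sup>2) * (LINT v|lebesgue. f v) - 2 * b * ((LINT v|lebesgue. f v *\<^sub>R v) \<bullet> w)
      + b * (LINT v|lebesgue. f v * (norm v)\<^sup>2)"
    unfolding eq
    by (simp only: Bochner_Integration.integral_add[OF Bochner_Integration.integrable_diff[OF i1 i2] i3]
        Bochner_Integration.integral_diff[OF i1 i2] integral_mult_right_zero inner)
qed

text \<open>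
  The moments are used only through this consequence: quadratic polynomials in \<open>v\<close> of the form occurring
  as logarithms of Maxwellians have equal integrals.
\<close>
lemma same_moments_quadratic:
  assumes "f \<in> L12" "g \<in> L12" "same_moments f g"
  shows "(LINT v|lebesgue. f v * (a + b * (norm (v - w))\<^sup>2)) = (LINT v|lebesgue. g v * (a + b * (norm (v - w))\<^sup>2))"
  using assms by (simp add: L12_quadratic same_moments_def)

lemma same_moments_centred:
  assumes f: "f \<in> L12" and g: "g \<in> L12"
    and 0: "(LINT v|lebesgue. f v) = (LINT v|lebesgue. g v)"
    and 1: "(LINT v|lebesgue. f v *\<^sub>R (v - w)) = (LINT v|lebesgue. g v *\<^sub>R (v - w))"
    and 2: "(LINT v|lebesgue. f v * (norm (v - w))\<^sup>2) = (LINT v|lebesgue. g v * (norm (v - w))\<^sup>2)"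
  shows "same_moments f g"
proof -
  have "(LINT v|lebesgue. h v *\<^sub>R (v - w)) = (LINT v|lebesgue. h v *\<^sub>R v) - (LINT v|lebesgue. h v) *\<^sub>R w"
    if "h \<in> L12" for h
    unfolding scaleR_diff_right
    using L12_integrable[OF that]
    by (subst Bochner_Integration.integral_diff) (auto simp: integral_scaleR_left integrable_scaleR_left)
  then have m: "(LINT v|lebesgue. f v *\<^sub>R v) = (LINT v|lebesgue. g v *\<^sub>R v)"
    using 0 1 f g by simp
  moreover have "(LINT v|lebesgue. f v * (norm v)\<^sup>2) = (LINT v|lebesgue. g v * (norm v)\<^sup>2)"
    using L12_quadratic(2)[OF f, of 0 1 w] L12_quadratic(2)[OF g, of 0 1 w] 0 2 m by simp
  ultimately show ?thesis using 0 by (simp add: same_moments_def)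
qed

text \<open>
  The parametrization with \<open>\<beta> > 0\<close> measures the distance to \<open>w\<close> in units of \<open>1 / sqrt \<beta>\<close>, so
  that all distributions with the same \<open>\<epsilon>\<close> and \<open>a\<close> are rescalings of one profile.
\<close>
definition fermi_dirac :: "real \<Rightarrow> real \<Rightarrow> real \<Rightarrow> real^3 \<Rightarrow> real^3 \<Rightarrow> real" where
  "fermi_dirac \<epsilon> a \<beta> w v = fd_profile \<epsilon> a (\<beta> * (norm (v - w))\<^sup>2)"

lemma fermi_dirac_dist_iff: "fermi_dirac_dist \<epsilon> M \<longleftrightarrow> (\<exists>a \<beta> w. 0 < \<beta> \<and> M = fermi_dirac \<epsilon> a \<beta> w)"
proof
  assume "fermi_dirac_dist \<epsilon> M"
  then obtain a b w where b: "b < 0" and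
    M: "M = (\<lambda>v. exp (a + b * (norm (v - w))\<^sup>2) / (1 + \<epsilon> * exp (a + b * (norm (v - w))\<^sup>2)))"
    by (auto simp: fermi_dirac_dist_def)
  then have "M = fermi_dirac \<epsilon> a (- b) w"
    by (simp add: fun_eq_iff fermi_dirac_def fd_profile_def)
  then show "\<exists>a \<beta> w. 0 < \<beta> \<and> M = fermi_dirac \<epsilon> a \<beta> w" using b by (intro exI[of _ a] exI[of _ "- b"] exI[of _ w]) simp
next
  assume "\<exists>a \<beta> w. 0 < \<beta> \<and> M = fermi_dirac \<epsilon> a \<beta> w"
  then obtain a \<beta> w where b: "0 < \<beta>" and M: "M = fermi_dirac \<epsilon> a \<beta> w" by auto
  have "M = (\<lambda>v. exp (a + - \<beta> * (norm (v - w))\<^sup>2) / (1 + \<epsilon> * exp (a + - \<beta> * (norm (v - w))\<^sup>2)))"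
    by (simp add: M fun_eq_iff fermi_dirac_def fd_profile_def)
  then show "fermi_dirac_dist \<epsilon> M"
    unfolding fermi_dirac_dist_def using b by (intro exI[of _ a] exI[of _ "- \<beta>"] exI[of _ w]) simp
qed

definition fd_mass :: "real \<Rightarrow> real \<Rightarrow> real" where
  "fd_mass \<epsilon> a = (LINT v|lborel. fd_profile \<epsilon> a ((norm (v::real^3))\<^sup>2))"

definition fd_energy :: "real \<Rightarrow> real \<Rightarrow> real" where
  "fd_energy \<epsilon> a = (LINT v|lborel. fd_profile \<epsilon> a ((norm (v::real^3))\<^sup>2) * (norm v)\<^sup>2)"

lemma integrable_fd_profile_power:
  assumes "0 \<le> \<epsilon>"
  shows "integrable lborel (\<lambda>v::real^3. fd_profile \<epsilon> a ((norm v)\<^sup>2) * norm v ^ k)"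
proof -
  have "integrable lborel (\<lambda>r. indicator {0..} r * (r\<^sup>2 * (fd_profile \<epsilon> a (r\<^sup>2) * r ^ k)))"
    using integrable_halfline_fd[OF assms, of "k + 2" a] by (simp only: power_add mult_ac)
  then show ?thesis by (subst polar) auto
qed

lemma fermi_dirac_pos: "0 \<le> \<epsilon> \<Longrightarrow> 0 < fermi_dirac \<epsilon> a \<beta> w v"
  by (simp add: fermi_dirac_def fd_profile_pos)

lemma measurable_fermi_dirac [measurable]: "fermi_dirac \<epsilon> a \<beta> w \<in> borel_measurable borel"
  unfolding fermi_dirac_def by measurable

lemma continuous_on_fermi_dirac: "0 \<le> \<epsilon> \<Longrightarrow> continuous_on S (fermi_dirac \<epsilon> a \<beta> w)"
  unfolding fermi_dirac_def by (intro continuous_intros)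

lemma fermi_dirac_rescale:
  "0 < c \<Longrightarrow> fermi_dirac \<epsilon> a (1 / c\<^sup>2) w (w + c *\<^sub>R v) = fd_profile \<epsilon> a ((norm v)\<^sup>2)"
  by (simp add: fermi_dirac_def power_mult_distrib)

text \<open>
  With \<open>\<beta> = 1 / c\<^sup>2\<close> the substitution \<open>v = w + c *\<^sub>R z\<close> reduces all moments to those of the centred
  profile of unit width; the first one vanishes by reflection.
\<close>
lemma fermi_dirac_moments:
  assumes e: "0 \<le> \<epsilon>" and c: "0 < c"
  shows "(LINT v|lebesgue. fermi_dirac \<epsilon> a (1 / c\<^sup>2) w v) = c ^ 3 * fd_mass \<epsilon> a"
    and "(LINT v|lebesgue. fermi_dirac \<epsilon> a (1 / c\<^sup>2) w v *\<^sub>R (v - w)) = 0"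
    and "(LINT v|lebesgue. fermi_dirac \<epsilon> a (1 / c\<^sup>2) w v * (norm (v - w))\<^sup>2) = c ^ 5 * fd_energy \<epsilon> a"
proof -
  have c0: "c \<noteq> 0" using c by simp
  show "(LINT v|lebesgue. fermi_dirac \<epsilon> a (1 / c\<^sup>2) w v) = c ^ 3 * fd_mass \<epsilon> a"
    using c
    by (subst integral_completion, simp, subst lborel_affine_integral(2)[OF c0, where w=w])
      (simp_all add: fermi_dirac_rescale fd_mass_def)
  have "(LINT v|lborel. fd_profile \<epsilon> a ((norm v)\<^sup>2) *\<^sub>R v) = - (LINT v|lborel. fd_profile \<epsilon> a ((norm v)\<^sup>2) *\<^sub>R (v::real^3))"
    by (subst lborel_affine_integral(2)[where w=0 and c="-1"]) simp_all
  then have "(LINT v|lborel. fd_profile \<epsilon> a ((norm v)\<^sup>2) *\<^sub>R (v::real^3)) = 0"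
    by (simp add: eq_neg_iff_add_eq_0 flip: scaleR_2)
  then have "(LINT v|lborel. c *\<^sub>R (fd_profile \<epsilon> a ((norm v)\<^sup>2) *\<^sub>R (v::real^3))) = 0"
    by (subst integral_scaleR_right) simp
  then show "(LINT v|lebesgue. fermi_dirac \<epsilon> a (1 / c\<^sup>2) w v *\<^sub>R (v - w)) = 0"
    using c
    by (subst integral_completion, measurable, subst lborel_affine_integral(2)[OF c0, where w=w])
      (simp_all add: fermi_dirac_rescale mult.commute)
  have "(LINT v|lebesgue. fermi_dirac \<epsilon> a (1 / c\<^sup>2) w v * (norm (v - w))\<^sup>2)
      = c ^ 3 * (LINT v|lborel. c\<^sup>2 * (fd_profile \<epsilon> a ((norm v)\<^sup>2) * (norm (v::real^3))\<^sup>2))"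
    using c
    by (subst integral_completion, measurable, subst lborel_affine_integral(2)[OF c0, where w=w])
      (simp_all add: fermi_dirac_rescale power_mult_distrib mult_ac)
  also have "\<dots> = c ^ 3 * (c\<^sup>2 * fd_energy \<epsilon> a)"
    by (simp only: fd_energy_def integral_mult_right_zero)
  also have "\<dots> = c ^ 5 * fd_energy \<epsilon> a"
    by (simp add: mult.assoc[symmetric] flip: power_add)
  finally show "(LINT v|lebesgue. fermi_dirac \<epsilon> a (1 / c\<^sup>2) w v * (norm (v - w))\<^sup>2) = c ^ 5 * fd_energy \<epsilon> a" .
qed

lemma fermi_dirac_L12:
  assumes e: "0 \<le> \<epsilon>" and b: "0 < \<beta>"
  shows "fermi_dirac \<epsilon> a \<beta> w \<in> L12"
proof -
  define c where "c = 1 / sqrt \<beta>"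
  have c: "0 < c" "\<beta> = 1 / c\<^sup>2" using b by (simp_all add: c_def power_divide)
  have "integrable lborel (\<lambda>v::real^3. (1 + 2 * (norm w)\<^sup>2) * (fd_profile \<epsilon> a ((norm v)\<^sup>2) * norm v ^ 0)
        + 2 * c\<^sup>2 * (fd_profile \<epsilon> a ((norm v)\<^sup>2) * norm v ^ 2))"
    by (intro Bochner_Integration.integrable_add integrable_mult_right integrable_fd_profile_power e)
  then have "integrable lborel (\<lambda>v::real^3. fd_profile \<epsilon> a ((norm v)\<^sup>2) * (1 + (norm (w + c *\<^sub>R v))\<^sup>2))"
  proof (rule Bochner_Integration.integrable_bound)
    show "AE v in lborel. norm (fd_profile \<epsilon> a ((norm v)\<^sup>2) * (1 + (norm (w + c *\<^sub>R v))\<^sup>2))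
      \<le> norm ((1 + 2 * (norm w)\<^sup>2) * (fd_profile \<epsilon> a ((norm v)\<^sup>2) * norm v ^ 0)
        + 2 * c\<^sup>2 * (fd_profile \<epsilon> a ((norm v)\<^sup>2) * norm v ^ 2))"
    proof (rule AE_I2)
      fix v :: "real^3"
      have "(norm (w + c *\<^sub>R v))\<^sup>2 \<le> (norm w + c * norm v)\<^sup>2"
        using norm_triangle_ineq[of w "c *\<^sub>R v"] c by (intro power_mono) auto
      also have "\<dots> \<le> 2 * (norm w)\<^sup>2 + 2 * c\<^sup>2 * (norm v)\<^sup>2"
        using sum_squares_bound[of "norm w" "c * norm v"] by (simp add: power2_sum power_mult_distrib)
      finally have "fd_profile \<epsilon> a ((norm v)\<^sup>2) * (1 + (norm (w + c *\<^sub>R v))\<^sup>2)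
        \<le> fd_profile \<epsilon> a ((norm v)\<^sup>2) * (1 + 2 * (norm w)\<^sup>2 + 2 * c\<^sup>2 * (norm v)\<^sup>2)"
        using fd_profile_pos[OF e, of a "(norm v)\<^sup>2"] by (intro mult_left_mono) auto
      then show "norm (fd_profile \<epsilon> a ((norm v)\<^sup>2) * (1 + (norm (w + c *\<^sub>R v))\<^sup>2))
        \<le> norm ((1 + 2 * (norm w)\<^sup>2) * (fd_profile \<epsilon> a ((norm v)\<^sup>2) * norm v ^ 0)
        + 2 * c\<^sup>2 * (fd_profile \<epsilon> a ((norm v)\<^sup>2) * norm v ^ 2))"
        using fd_profile_pos[OF e, of a "(norm v)\<^sup>2"] by (simp add: abs_mult algebra_simps)
    qed
  qed measurable
  then have "integrable lborel (\<lambda>v. fermi_dirac \<epsilon> a \<beta> w v * (1 + (norm v)\<^sup>2))"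
    using c by (subst lborel_affine_integral(1)[where w=w and c=c]) (simp_all add: fermi_dirac_rescale)
  then show ?thesis
    using fermi_dirac_pos[OF e, of a \<beta> w]
    by (simp add: L12_def integrable_completion abs_of_pos measurable_completion)
qed

section \<open>Uniqueness of equilibria and existence of Maxwellians\<close>

text \<open>
  Equal moments make the integral of \<open>M - N\<close> against the difference of the two exponents vanish.
  The integrand \<open>(M - N) * (l - l')\<close> is nonnegative because the profile increases with
  the exponent, hence vanishes almost everywhere, and everywhere by continuity.
\<close>
lemma fermi_dirac_unique:
  assumes e: "0 \<le> \<epsilon>" and M: "fermi_dirac_dist \<epsilon> M" and N: "fermi_dirac_dist \<epsilon> N" and mom: "same_moments M N"
  shows "M = N"
proof -
  obtain a \<beta> w where M': "0 < \<beta>" "M = fermi_dirac \<epsilon> a \<beta> w"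
    using M by (auto simp: fermi_dirac_dist_iff)
  obtain a' \<beta>' w' where N': "0 < \<beta>'" "N = fermi_dirac \<epsilon> a' \<beta>' w'"
    using N by (auto simp: fermi_dirac_dist_iff)
  define l where "l v = a + (- \<beta>) * (norm (v - w))\<^sup>2" for v
  define l' where "l' v = a' + (- \<beta>') * (norm (v - w'))\<^sup>2" for v
  define D where "D v = (M v - N v) * (l v - l' v)" for v
  have L: "M \<in> L12" "N \<in> L12" unfolding M' N' by (intro fermi_dirac_L12 e M' N')+
  have Dsplit: "D v = (M v * l v - N v * l v) - (M v * l' v - N v * l' v)" for v
    by (simp add: D_def algebra_simps)
  have ints: "integrable lebesgue (\<lambda>v. M v * l v)" "integrable lebesgue (\<lambda>v. N v * l v)"
     "integrable lebesgue (\<lambda>v. M v * l' v)" "integrable lebesgue (\<lambda>v. N v * l' v)"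
    unfolding l_def l'_def by (intro L12_quadratic L)+
  have D_int: "integrable lebesgue D"
    unfolding Dsplit[abs_def] by (intro Bochner_Integration.integrable_diff ints)
  have "(LINT v|lebesgue. D v) = 0"
    unfolding Dsplit using ints same_moments_quadratic[OF L mom, of a "- \<beta>" w] same_moments_quadratic[OF L mom, of a' "- \<beta>'" w']
    by (simp add: Bochner_Integration.integral_diff Bochner_Integration.integrable_diff l_def l'_def del: mult_minus_left)
  moreover have D0: "0 \<le> D v" and Deq: "D v = 0 \<Longrightarrow> M v = N v" for v
  proof -
    have "mono_on UNIV (\<lambda>y. exp y / (1 + \<epsilon> * exp y))"
      using e by (intro mono_onI) (simp add: divide_simps add_pos_nonneg fd_denom_pos algebra_simps)
    moreover have M_l: "M v = exp (l v) / (1 + \<epsilon> * exp (l v))" "N v = exp (l' v) / (1 + \<epsilon> * exp (l' v))"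
      by (simp_all add: M' N' fermi_dirac_def fd_profile_def l_def l'_def)
    ultimately show "0 \<le> D v"
      unfolding D_def by (cases "l v \<le> l' v") (auto simp: mono_on_def mult_nonpos_nonpos)
    show "M v = N v" if "D v = 0"
      using that M_l by (auto simp: D_def)
  qed
  ultimately have "AE v in lebesgue. D v = 0"
    using integral_nonneg_eq_0_iff_AE[OF D_int] by simp
  then have "{v. D v \<noteq> 0} \<in> null_sets lebesgue"
    by (simp add: eventually_ae_filter_negligible negligible_iff_null_sets)
      (metis (mono_tags) negligible_iff_null_sets negligible_subset)
  then have "negligible {v. D v \<noteq> 0}" by (simp add: negligible_iff_null_sets)
  moreover have "open {v. D v \<noteq> 0}"
  proof (rule open_Collect_neq)
    show "continuous_on UNIV D"
      unfolding D_def M' N' l_def l'_def by (intro continuous_intros continuous_on_fermi_dirac e)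
  qed simp
  ultimately have "{v. D v \<noteq> 0} = {}" using open_not_negligible by blast
  then show ?thesis using Deq by (auto simp: fun_eq_iff)
qed

lemma equilibriumI:
  assumes "0 \<le> \<epsilon>" "0 < \<beta>" "same_moments (fermi_dirac \<epsilon> a \<beta> w) f"
  shows "equilibrium \<epsilon> f = fermi_dirac \<epsilon> a \<beta> w"
  unfolding equilibrium_def
proof (rule the_equality)
  show "fermi_dirac_dist \<epsilon> (fermi_dirac \<epsilon> a \<beta> w) \<and> same_moments (fermi_dirac \<epsilon> a \<beta> w) f"
    using assms by (auto simp: fermi_dirac_dist_iff)
  then show "M = fermi_dirac \<epsilon> a \<beta> w" if "fermi_dirac_dist \<epsilon> M \<and> same_moments M f" for M
    using that by (intro fermi_dirac_unique[OF assms(1)]) (auto simp: same_moments_def)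
qed

definition mass :: "(real^3 \<Rightarrow> real) \<Rightarrow> real" where "mass f = (LINT v|lebesgue. f v)"
definition mean :: "(real^3 \<Rightarrow> real) \<Rightarrow> real^3" where "mean f = (LINT v|lebesgue. f v *\<^sub>R v) /\<^sub>R mass f"
definition spread :: "(real^3 \<Rightarrow> real) \<Rightarrow> real" where "spread f = (LINT v|lebesgue. f v * (norm (v - mean f))\<^sup>2)"

lemma mass_pos:
  assumes "f \<in> L12" "\<not> (AE v in lebesgue. f v = 0)" "AE v in lebesgue. 0 \<le> f v"
  shows "0 < mass f"
proof -
  have "0 \<le> mass f" unfolding mass_def using assms by (intro integral_nonneg_AE)
  moreover have "mass f \<noteq> 0"
    unfolding mass_def using assms L12_integrable(1)[OF assms(1)] by (subst integral_nonneg_eq_0_iff_AE) auto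
  ultimately show ?thesis by simp
qed

lemma spread_pos:
  assumes "f \<in> L12" "\<not> (AE v in lebesgue. f v = 0)" "AE v in lebesgue. 0 \<le> f v"
  shows "0 < spread f"
proof -
  have int: "integrable lebesgue (\<lambda>v. f v * (norm (v - mean f))\<^sup>2)"
    using L12_quadratic(1)[OF assms(1), of 0 1 "mean f"] by simp
  have nn: "AE v in lebesgue. 0 \<le> f v * (norm (v - mean f))\<^sup>2" using assms(3) by eventually_elim simp
  have "0 \<le> spread f" unfolding spread_def using nn by (intro integral_nonneg_AE)
  moreover have "spread f \<noteq> 0"
  proof
    assume "spread f = 0"
    then have "AE v in lebesgue. f v * (norm (v - mean f))\<^sup>2 = 0"
      using integral_nonneg_eq_0_iff_AE[OF int nn] by (simp add: spread_def)
    moreover have "AE v in lebesgue. v \<noteq> mean f" 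
      by (rule AE_completion) (simp add: AE_lborel_singleton)
    ultimately have "AE v in lebesgue. f v = 0" by eventually_elim auto
    with assms(2) show False by simp
  qed
  ultimately show ?thesis by simp
qed

lemma same_moments_fermi_dirac:
  assumes f: "f \<in> L12" "0 < mass f" and e: "0 \<le> \<epsilon>" and c: "0 < c"
    and m: "c ^ 3 * fd_mass \<epsilon> a = mass f" and s: "c ^ 5 * fd_energy \<epsilon> a = spread f"
  shows "same_moments (fermi_dirac \<epsilon> a (1 / c\<^sup>2) (mean f)) f"
proof (rule same_moments_centred[where w="mean f"])
  show "fermi_dirac \<epsilon> a (1 / c\<^sup>2) (mean f) \<in> L12" using c by (intro fermi_dirac_L12 e) simp
  have "(LINT v|lebesgue. f v *\<^sub>R (v - mean f)) = (LINT v|lebesgue. f v *\<^sub>R v) - mass f *\<^sub>R mean f"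
    unfolding scaleR_diff_right mass_def using L12_integrable[OF f(1)]
    by (subst Bochner_Integration.integral_diff) (auto simp: integral_scaleR_left integrable_scaleR_left)
  then show "(LINT v|lebesgue. fermi_dirac \<epsilon> a (1 / c\<^sup>2) (mean f) v *\<^sub>R (v - mean f))
     = (LINT v|lebesgue. f v *\<^sub>R (v - mean f))"
    using f(2) by (simp add: fermi_dirac_moments(2)[OF e c] mean_def)
qed (use fermi_dirac_moments[OF e c] f m s in \<open>simp_all add: mass_def spread_def\<close>)

lemma fermi_dirac_moments_of_match:
  assumes f: "f \<in> L12" and e: "0 \<le> \<epsilon>" and c: "0 < c"
    and sm: "same_moments (fermi_dirac \<epsilon> a (1 / c\<^sup>2) w) f"
  shows "mass f = c ^ 3 * fd_mass \<epsilon> a" 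
    and "(LINT v|lebesgue. f v * (norm (v - w))\<^sup>2) = c ^ 5 * fd_energy \<epsilon> a"
proof -
  have L: "fermi_dirac \<epsilon> a (1 / c\<^sup>2) w \<in> L12" using c by (intro fermi_dirac_L12 e) simp
  show "mass f = c ^ 3 * fd_mass \<epsilon> a" 
    using sm fermi_dirac_moments(1)[OF e c] by (simp add: same_moments_def mass_def)
  show "(LINT v|lebesgue. f v * (norm (v - w))\<^sup>2) = c ^ 5 * fd_energy \<epsilon> a"
    using same_moments_quadratic[OF L f sm, of 0 1 w] fermi_dirac_moments(3)[OF e c] by simp
qed

lemma fermi_dirac_not_AE_zero:
  assumes "0 \<le> \<epsilon>"
  shows "\<not> (AE v in lebesgue. fermi_dirac \<epsilon> a \<beta> w v = 0)"
proof
  assume "AE v in lebesgue. fermi_dirac \<epsilon> a \<beta> w v = 0"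
  then have "negligible (UNIV :: (real^3) set)"
    using fermi_dirac_pos[OF assms, THEN less_imp_neq, symmetric]
    by (auto simp: eventually_ae_filter_negligible top.extremum_unique)
  then show False using non_negligible_UNIV by simp
qed

lemma fd_mass_pos: assumes "0 \<le> \<epsilon>" shows "0 < fd_mass \<epsilon> a"
proof -
  have L: "fermi_dirac \<epsilon> a (1 / 1\<^sup>2) 0 \<in> L12" by (intro fermi_dirac_L12 assms) simp
  then have "0 < mass (fermi_dirac \<epsilon> a (1 / 1\<^sup>2) 0)"
    using fermi_dirac_not_AE_zero[OF assms] fermi_dirac_pos[OF assms] by (intro mass_pos) (auto intro!: AE_I2 less_imp_le)
  then show ?thesis using fermi_dirac_moments(1)[OF assms zero_less_one] by (simp add: mass_def)
qed

lemma fd_energy_pos: assumes "0 \<le> \<epsilon>" shows "0 < fd_energy \<epsilon> a"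
proof -
  let ?M = "fermi_dirac \<epsilon> a (1 / 1\<^sup>2) 0"
  have L: "?M \<in> L12" by (intro fermi_dirac_L12 assms) simp
  have n: "\<not> (AE v in lebesgue. ?M v = 0)" by (rule fermi_dirac_not_AE_zero[OF assms])
  have p: "AE v in lebesgue. 0 \<le> ?M v" using fermi_dirac_pos[OF assms] by (auto intro!: AE_I2 less_imp_le)
  have "mean ?M = 0"
    using fermi_dirac_moments(2)[OF assms zero_less_one, of a 0] by (simp add: mean_def)
  then show ?thesis using spread_pos[OF L n p] fermi_dirac_moments(3)[OF assms zero_less_one, of a 0]
    by (simp add: spread_def)
qed

text \<open>
  For \<open>\<epsilon> = 0\<close> the parameter \<open>a\<close> is only a factor, so the ratio of energy to mass determines the width
  and the mass then determines \<open>a\<close>.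
\<close>
lemma maxwellian_exists:
  assumes f: "f \<in> L12" "\<not> (AE v in lebesgue. f v = 0)" "AE v in lebesgue. 0 \<le> f v"
  shows "\<exists>a \<beta> w. 0 < \<beta> \<and> same_moments (fermi_dirac 0 a \<beta> w) f"
proof -
  have m: "0 < mass f" "0 < spread f" using mass_pos[OF f] spread_pos[OF f] by auto
  have I: "0 < fd_mass 0 0" "0 < fd_energy 0 0" by (simp_all add: fd_mass_pos fd_energy_pos)
  define c where "c = sqrt (spread f / mass f * (fd_mass 0 0 / fd_energy 0 0))"
  define a where "a = ln (mass f / (c ^ 3 * fd_mass 0 0))"
  have c: "0 < c" using m I by (simp add: c_def)
  have c2: "c\<^sup>2 = spread f / mass f * (fd_mass 0 0 / fd_energy 0 0)"
    using m I by (simp add: c_def)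
  have prof: "fd_profile 0 a x = exp a * fd_profile 0 0 x" for x
    by (simp add: fd_profile_def exp_diff exp_minus divide_inverse)
  have mm: "fd_mass 0 a = exp a * fd_mass 0 0" "fd_energy 0 a = exp a * fd_energy 0 0"
    unfolding fd_mass_def fd_energy_def prof mult.assoc by simp_all
  have ea: "exp a = mass f / (c ^ 3 * fd_mass 0 0)" using m I c by (simp add: a_def)
  have "same_moments (fermi_dirac 0 a (1 / c\<^sup>2) (mean f)) f"
  proof (rule same_moments_fermi_dirac)
    show M: "c ^ 3 * fd_mass 0 a = mass f" using c I by (simp add: mm ea)
    have "c ^ 5 * fd_energy 0 a = c\<^sup>2 * (c ^ 3 * fd_mass 0 a) * (fd_energy 0 0 / fd_mass 0 0)"
      using I by (simp add: mm field_simps flip: power_add)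
    also have "\<dots> = spread f" unfolding M using I m by (simp add: c2)
    finally show "c ^ 5 * fd_energy 0 a = spread f" .
  qed (use f m c in auto)
  then show ?thesis using c by (intro exI[of _ a] exI[of _ "1 / c\<^sup>2"] exI[of _ "mean f"]) simp
qed

section \<open>Existence of Fermi-Dirac equilibria and their fugacity\<close>

lemma integral_ball_test_function:
  assumes R: "0 < R"
  shows "integrable lebesgue (\<lambda>v::real^3. max 0 (R\<^sup>2 - (norm (v - w))\<^sup>2))"
    and "(LINT v|lebesgue. max 0 (R\<^sup>2 - (norm (v - w :: real^3))\<^sup>2)) = 8 / 15 * pi * R ^ 5"
proof -
  have eq: "indicator {0..} r * (r\<^sup>2 * max 0 (R\<^sup>2 - r\<^sup>2)) = r\<^sup>2 * (R\<^sup>2 - r\<^sup>2) * indicator {0..R} r" for r :: real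
    using R power_mono[of r R 2] power_mono[of R r 2] by (auto simp: max_def split: split_indicator)
  have h: "has_bochner_integral lborel (\<lambda>r. r\<^sup>2 * (R\<^sup>2 - r\<^sup>2) * indicator {0..R} r)
     ((R\<^sup>2 * R ^ 3 / 3 - R ^ 5 / 5) - (R\<^sup>2 * 0 ^ 3 / 3 - 0 ^ 5 / 5))"
  proof (rule has_bochner_integral_FTC_Icc_real)
    show "((\<lambda>r. R\<^sup>2 * r ^ 3 / 3 - r ^ 5 / 5) has_real_derivative r\<^sup>2 * (R\<^sup>2 - r\<^sup>2)) (at r)" for r
      by (rule derivative_eq_intros refl | simp)+ (simp add: algebra_simps power_numeral_reduce)
  qed (use R in \<open>auto intro!: continuous_intros\<close>)
  have i: "integrable lborel (\<lambda>v::real^3. max 0 (R\<^sup>2 - (norm v)\<^sup>2))"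
    using h by (subst polar) (auto simp: eq has_bochner_integral_iff)
  then show "integrable lebesgue (\<lambda>v::real^3. max 0 (R\<^sup>2 - (norm (v - w))\<^sup>2))"
    by (subst integrable_completion, simp, subst lborel_affine_integral(1)[where w=w and c=1]) simp_all
  have "(LINT v|lebesgue. max 0 (R\<^sup>2 - (norm (v - w :: real^3))\<^sup>2)) = (LINT v|lborel. max 0 (R\<^sup>2 - (norm (v::real^3))\<^sup>2))"
    by (subst integral_completion, simp, subst lborel_affine_integral(2)[where w=w and c=1]) simp_all
  also have "\<dots> = 4 * pi * (LINT r|lborel. indicator {0..} r * (r\<^sup>2 * max 0 (R\<^sup>2 - r\<^sup>2)))"
    by (rule polar(2)) measurable
  also have "\<dots> = 4 * pi * (R\<^sup>2 * R ^ 3 / 3 - R ^ 5 / 5)"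
    using h by (simp add: eq has_bochner_integral_iff)
  also have "\<dots> = 8 / 15 * pi * R ^ 5"
    by (simp flip: power_add)
  finally show "(LINT v|lebesgue. max 0 (R\<^sup>2 - (norm (v - w :: real^3))\<^sup>2)) = 8 / 15 * pi * R ^ 5" .
qed

text \<open>
  Among functions between \<open>0\<close> and \<open>h\<close>, the integral against \<open>R\<^sup>2 - |v - w|\<^sup>2\<close> is largest for
  \<open>h\<close> times the indicator function of the ball where this weight is positive.
\<close>
lemma bathtub:
  assumes f: "f \<in> L12" "AE v in lebesgue. 0 \<le> f v" "AE v in lebesgue. f v \<le> h" and R: "0 < R"
  shows "mass f * R\<^sup>2 - (LINT v|lebesgue. f v * (norm (v - w))\<^sup>2) \<le> h * (8 / 15 * pi * R ^ 5)"
proof -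
  have "(LINT v|lebesgue. f v * (R\<^sup>2 + - 1 * (norm (v - w))\<^sup>2)) \<le> (LINT v|lebesgue. h * max 0 (R\<^sup>2 - (norm (v - w))\<^sup>2))"
  proof (rule integral_mono_AE)
    show "AE v in lebesgue. f v * (R\<^sup>2 + - 1 * (norm (v - w))\<^sup>2) \<le> h * max 0 (R\<^sup>2 - (norm (v - w))\<^sup>2)"
      using f(2,3)
    proof eventually_elim
      case (elim v)
      have "f v * (R\<^sup>2 + - 1 * (norm (v - w))\<^sup>2) \<le> f v * max 0 (R\<^sup>2 - (norm (v - w))\<^sup>2)"
        using elim by (intro mult_left_mono) auto
      also have "\<dots> \<le> h * max 0 (R\<^sup>2 - (norm (v - w))\<^sup>2)"
        using elim by (intro mult_right_mono) auto
      finally show ?case .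
    qed
  qed (intro L12_quadratic f integrable_mult_right integral_ball_test_function R)+
  also have "(LINT v|lebesgue. f v * (R\<^sup>2 + - 1 * (norm (v - w))\<^sup>2))
      = mass f * R\<^sup>2 - (LINT v|lebesgue. f v * (norm (v - w))\<^sup>2)"
    using L12_quadratic(2)[OF f(1), of "R\<^sup>2" "-1" w] L12_quadratic(2)[OF f(1), of 0 1 w]
    by (simp add: mass_def algebra_simps)
  also have "(LINT v|lebesgue. h * max 0 (R\<^sup>2 - (norm (v - w))\<^sup>2)) = h * (8 / 15 * pi * R ^ 5)"
    by (simp only: integral_mult_right_zero integral_ball_test_function(2)[OF R])
  finally show ?thesis .
qed

text \<open>
  The one-dimensional bound transported to a distribution of width \<open>c\<close>, in terms of its mass and
  energy. It is used in both directions: for existence and for the fugacity bound.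
\<close>
lemma fd_ball_bound:
  assumes c: "0 < c"
  shows "\<exists>R>0. ln (1 + exp a) / (8 + ln (1 + exp a)) * (8 / 15 * pi * R ^ 5)
     \<le> c ^ 3 * fd_mass 1 a * R\<^sup>2 - c ^ 5 * fd_energy 1 a"
proof -
  define H where "H = ln (1 + exp a) / (8 + ln (1 + exp a))"
  obtain R where R: "0 < R" "H * (2 / 15 * R ^ 5) \<le> ball_test a R"
    using ball_test_lower_bound[of a] by (auto simp: H_def)
  have i: "integrable lborel (\<lambda>v::real^3. fd_profile 1 a ((norm v)\<^sup>2))"
          "integrable lborel (\<lambda>v::real^3. fd_profile 1 a ((norm v)\<^sup>2) * (norm v)\<^sup>2)"
    using integrable_fd_profile_power[of 1 a 0] integrable_fd_profile_power[of 1 a 2] by simp_all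
  have "R\<^sup>2 * fd_mass 1 a - fd_energy 1 a
      = (LINT v|lborel. R\<^sup>2 * fd_profile 1 a ((norm (v::real^3))\<^sup>2) - fd_profile 1 a ((norm v)\<^sup>2) * (norm v)\<^sup>2)"
    unfolding fd_mass_def fd_energy_def using i by simp
  also have "\<dots> = 4 * pi * (LINT r|lborel. indicator {0..} r * (r\<^sup>2 * (R\<^sup>2 * fd_profile 1 a (r\<^sup>2) - fd_profile 1 a (r\<^sup>2) * r\<^sup>2)))"
    by (rule polar(2)) measurable
  also have "\<dots> = 4 * pi * ball_test a R"
    by (simp add: ball_test_def algebra_simps)
  also have "\<dots> \<ge> 4 * pi * (H * (2 / 15 * R ^ 5))"
    using R(2) by (intro mult_left_mono) auto
  finally have "H * (8 / 15 * pi * R ^ 5) \<le> R\<^sup>2 * fd_mass 1 a - fd_energy 1 a"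
    by (simp add: mult_ac)
  then have "c ^ 5 * (H * (8 / 15 * pi * R ^ 5)) \<le> c ^ 5 * (R\<^sup>2 * fd_mass 1 a - fd_energy 1 a)"
    using c by (intro mult_left_mono) auto
  also have "\<dots> = c ^ 3 * fd_mass 1 a * (c * R)\<^sup>2 - c ^ 5 * fd_energy 1 a"
    by (simp add: power_mult_distrib right_diff_distrib mult_ac flip: power_add)
  finally have "H * (8 / 15 * pi * (c * R) ^ 5) \<le> c ^ 3 * fd_mass 1 a * (c * R)\<^sup>2 - c ^ 5 * fd_energy 1 a"
    by (simp add: power_mult_distrib mult_ac)
  then show ?thesis using R c unfolding H_def by (intro exI[of _ "c * R"]) auto
qed

lemma continuous_fd_moments:
  shows "isCont (fd_mass 1) a" "isCont (fd_energy 1) a"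
proof -
  have *: "isCont (\<lambda>a. LINT v|lborel. fd_profile 1 a ((norm (v::real^3))\<^sup>2) * norm v ^ k) a" for k
  proof (rule continuous_at_sequentiallyI)
    fix u :: "nat \<Rightarrow> real"
    assume u: "u \<longlonglongrightarrow> a"
    then obtain B where B: "\<And>n. u n \<le> B"
    proof -
      have "Bseq u" using u by (auto intro: convergent_imp_Bseq convergentI)
      then obtain K where "\<forall>n. norm (u n) \<le> K" by (rule BseqE)
      then have "u n \<le> K" for n using abs_ge_self order_trans unfolding real_norm_def by blast
      then show ?thesis by (rule that)
    qed
    show "(\<lambda>n. LINT v|lborel. fd_profile 1 (u n) ((norm (v::real^3))\<^sup>2) * norm v ^ k)
      \<longlonglongrightarrow> (LINT v|lborel. fd_profile 1 a ((norm (v::real^3))\<^sup>2) * norm v ^ k)"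
    proof (rule integral_dominated_convergence[where w="\<lambda>v. fd_profile 0 B ((norm (v::real^3))\<^sup>2) * norm v ^ k"])
      show "integrable lborel (\<lambda>v. fd_profile 0 B ((norm (v::real^3))\<^sup>2) * norm v ^ k)"
        by (rule integrable_fd_profile_power) simp
      have "isCont (\<lambda>y. fd_profile 1 y x) a" for x
        unfolding fd_profile_def using fd_denom_pos[of 1 "a - x"] by (intro continuous_intros) auto
      then show "AE v in lborel. (\<lambda>n. fd_profile 1 (u n) ((norm (v::real^3))\<^sup>2) * norm v ^ k)
         \<longlonglongrightarrow> fd_profile 1 a ((norm v)\<^sup>2) * norm v ^ k"
        using u by (intro AE_I2 tendsto_intros) (rule isCont_tendsto_compose)
      have "fd_profile 1 (u n) x \<le> fd_profile 0 B x" for n x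
      proof -
        have "fd_profile 1 (u n) x \<le> exp (u n) * exp (- x)" by (rule fd_profile_le_exp) simp
        also have "\<dots> \<le> exp B * exp (- x)" using B by (intro mult_right_mono) auto
        finally show ?thesis by (simp add: fd_profile_def exp_diff exp_minus divide_inverse)
      qed
      then show "AE v in lborel. norm (fd_profile 1 (u n) ((norm (v::real^3))\<^sup>2) * norm v ^ k)
        \<le> fd_profile 0 B ((norm v)\<^sup>2) * norm v ^ k" for n
        using fd_profile_pos[of 1 "u n"] by (intro AE_I2) (auto simp: abs_mult abs_of_pos intro!: mult_right_mono)
    qed measurable
  qed
  show "isCont (fd_mass 1) a" "isCont (fd_energy 1) a"
    using *[of 0] *[of 2] by (simp_all add: fd_mass_def[abs_def] fd_energy_def[abs_def])
qed

text \<open>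
  For \<open>a \<le> 0\<close> the profile lies between half a Maxwellian and that Maxwellian.
\<close>
lemma fd_moments_dilute:
  assumes "a \<le> 0"
  shows "fd_mass 1 a \<le> exp a * fd_mass 0 0" "exp a * fd_energy 0 0 / 2 \<le> fd_energy 1 a"
proof -
  have prof: "fd_profile 1 a x \<le> exp a * fd_profile 0 0 x" for x
    using fd_profile_le_exp[of 1 a x] by (simp add: fd_profile_def exp_minus)
  have prof': "exp a * fd_profile 0 0 x / 2 \<le> fd_profile 1 a x" if "0 \<le> x" for x
  proof -
    have "exp (a - x) \<le> 1" using assms that by simp
    then have "exp (a - x) / 2 \<le> exp (a - x) / (1 + 1 * exp (a - x))"
      by (intro divide_left_mono) (auto simp: add_pos_pos)
    moreover have "exp a * fd_profile 0 0 x = exp (a - x)" by (simp add: fd_profile_def flip: exp_add)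
    ultimately show ?thesis by (simp add: fd_profile_def)
  qed
  have i: "integrable lborel (\<lambda>v::real^3. fd_profile \<epsilon> a ((norm v)\<^sup>2))"
          "integrable lborel (\<lambda>v::real^3. fd_profile \<epsilon> a ((norm v)\<^sup>2) * (norm v)\<^sup>2)" if "0 \<le> \<epsilon>" for \<epsilon> a
    using integrable_fd_profile_power[OF that, of a 0] integrable_fd_profile_power[OF that, of a 2] by simp_all
  have "fd_mass 1 a \<le> (LINT v|lborel. exp a * fd_profile 0 0 ((norm (v::real^3))\<^sup>2))"
    unfolding fd_mass_def using i by (intro integral_mono prof integrable_mult_right) auto
  then show "fd_mass 1 a \<le> exp a * fd_mass 0 0" by (simp add: fd_mass_def)
  have "(LINT v|lborel. exp a / 2 * (fd_profile 0 0 ((norm (v::real^3))\<^sup>2) * (norm v)\<^sup>2)) \<le> fd_energy 1 a"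
    unfolding fd_energy_def
  proof (intro integral_mono integrable_mult_right i)
    fix v :: "real^3"
    show "exp a / 2 * (fd_profile 0 0 ((norm v)\<^sup>2) * (norm v)\<^sup>2) \<le> fd_profile 1 a ((norm v)\<^sup>2) * (norm v)\<^sup>2"
      using mult_right_mono[OF prof'[of "(norm v)\<^sup>2"], of "(norm v)\<^sup>2"] by simp
  qed auto
  then show "exp a * fd_energy 0 0 / 2 \<le> fd_energy 1 a"
    by (simp add: fd_energy_def)
qed

text \<open>
  Given \<open>a\<close>, the mass determines the width \<open>c a\<close>, and the energy \<open>d a\<close> is then a continuous function.
  If \<open>a\<close> is chosen with \<open>L / (8 + L) = h\<close>, then \<open>fd_ball_bound\<close> and the hypothesis on \<open>m\<close> and \<open>s\<close> at the
  same radius give \<open>d a \<le> s\<close>. If \<open>a\<close> is very negative, the width must be large to hold the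
  mass, and \<open>d a\<close> exceeds \<open>s\<close>.
\<close>
lemma fd_moments_surjective:
  assumes m: "0 < m" and s: "0 < s" and h: "0 < h" "h < 1"
    and ball: "\<And>R. 0 < R \<Longrightarrow> m * R\<^sup>2 - s \<le> h * (8 / 15 * pi * R ^ 5)"
  shows "\<exists>a c. 0 < c \<and> c ^ 3 * fd_mass 1 a = m \<and> c ^ 5 * fd_energy 1 a = s"
proof -
  define c where "c a = root 3 (m / fd_mass 1 a)" for a
  define d where "d a = c a ^ 5 * fd_energy 1 a" for a
  have mp: "0 < fd_mass 1 a" "0 < fd_energy 1 a" for a by (simp_all add: fd_mass_pos fd_energy_pos)
  have c: "0 < c a" "c a ^ 3 = m / fd_mass 1 a" for a
    using m mp by (simp_all add: c_def odd_real_root_pow)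
  have cm: "c a ^ 3 * fd_mass 1 a = m" for a using mp[of a] by (simp add: c)
  have "isCont d a" for a
    unfolding d_def c_def using mp[of a]
    by (intro continuous_intros continuous_fd_moments) auto
  then have cont: "continuous_on UNIV d" by (simp add: continuous_on_eq_continuous_at)
  \<comment> \<open>The value of \<open>L\<close> below solves \<open>L / (8 + L) = h\<close>.\<close>
  obtain a\<^sub>1 where a1: "d a\<^sub>1 \<le> s"
  proof -
    define L where "L = 8 * h / (1 - h)"
    define a where "a = ln (exp L - 1)"
    have L: "0 < L" using h by (simp add: L_def)
    then have "exp a = exp L - 1" by (simp add: a_def)
    then have La: "ln (1 + exp a) = L" by simp
    have "L / (8 + L) = h" using h by (simp add: L_def field_simps)
    then obtain R where R: "0 < R" "h * (8 / 15 * pi * R ^ 5) \<le> m * R\<^sup>2 - d a"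
      using fd_ball_bound[OF c(1)[of a], of a] unfolding La cm d_def by auto
    then have "d a \<le> s" using ball[of R] by simp
    then show ?thesis by (rule that)
  qed
  obtain a\<^sub>2 where a2: "s \<le> d a\<^sub>2"
  proof -
    define I where "I = fd_mass 0 0"
    define J where "J = fd_energy 0 0"
    have IJ: "0 < I" "0 < J" by (simp_all add: I_def J_def fd_mass_pos fd_energy_pos)
    \<comment> \<open>\<open>Z\<close> is the width that suffices for energy \<open>s\<close>, because the energy per mass is at least \<open>c\<^sup>2 * J / (2 * I)\<close>.\<close>
    define Z where "Z = sqrt (2 * I * s / (m * J))"
    have Z: "0 < Z" "Z\<^sup>2 = 2 * I * s / (m * J)" using IJ m s by (simp_all add: Z_def)
    define a where "a = min 0 (ln (m / (I * Z ^ 3)))"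
    have a0: "a \<le> 0" by (simp add: a_def)
    have "exp a \<le> exp (ln (m / (I * Z ^ 3)))" unfolding exp_le_cancel_iff a_def by simp
    then have ea: "exp a \<le> m / (I * Z ^ 3)" using m IJ Z by simp
    have M: "fd_mass 1 a \<le> exp a * I" "exp a * J / 2 \<le> fd_energy 1 a"
      using fd_moments_dilute[OF a0] by (simp_all add: I_def J_def)
    have "Z ^ 3 * fd_mass 1 a \<le> Z ^ 3 * (m / (I * Z ^ 3) * I)"
      using M(1) mult_right_mono[OF ea, of I] IJ Z by (intro mult_left_mono) auto
    also have "\<dots> = m" using IJ Z by simp
    finally have "Z ^ 3 \<le> c a ^ 3" using mp[of a] by (simp add: c pos_le_divide_eq)
    then have Zc: "Z \<le> c a" using c(1)[of a] power_le_imp_le_base[of Z 2 "c a"] by (simp add: numeral_3_eq_3)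
    have "s = Z\<^sup>2 * (m * (J / (2 * I)))" using Z IJ m by simp
    also have "\<dots> \<le> (c a)\<^sup>2 * (m * (fd_energy 1 a / fd_mass 1 a))"
    proof (intro mult_mono power_mono Zc)
      have "J * fd_mass 1 a \<le> J * (exp a * I)" using M IJ by (intro mult_left_mono) auto
      also have "\<dots> = 2 * I * (exp a * J / 2)" by simp
      also have "\<dots> \<le> 2 * I * fd_energy 1 a" using M IJ by (intro mult_left_mono) auto
      finally show "J / (2 * I) \<le> fd_energy 1 a / fd_mass 1 a"
        using IJ mp[of a] by (simp add: divide_simps mult_ac)
    qed (use m IJ Z in auto)
    also have "\<dots> = (c a)\<^sup>2 * (c a ^ 3 * fd_mass 1 a * (fd_energy 1 a / fd_mass 1 a))" by (simp add: cm)
    also have "\<dots> = d a" using mp[of a] by (simp add: d_def mult.assoc[symmetric] flip: power_add)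
    finally show ?thesis by (rule that)
  qed
  have "connected (d ` UNIV)" by (intro connected_continuous_image cont connected_UNIV)
  then have "s \<in> range d" using a1 a2 unfolding connected_iff_interval by blast
  then obtain a where "d a = s" by auto
  then show ?thesis using c(1) cm unfolding d_def by blast
qed

lemma fd_profile_scale: "0 < \<epsilon> \<Longrightarrow> \<epsilon> * fd_profile \<epsilon> a x = fd_profile 1 (a + ln \<epsilon>) x"
  by (simp add: fd_profile_def exp_add exp_diff mult_ac)

lemma fd_moments_scale:
  assumes "0 < \<epsilon>"
  shows "\<epsilon> * fd_mass \<epsilon> a = fd_mass 1 (a + ln \<epsilon>)" "\<epsilon> * fd_energy \<epsilon> a = fd_energy 1 (a + ln \<epsilon>)"
  unfolding fd_mass_def fd_energy_def fd_profile_scale[OF assms, symmetric] mult.assoc by simp_all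

theorem fermi_dirac_equilibrium_exists:
  assumes f: "f \<in> L12" "\<not> (AE v in lebesgue. f v = 0)" "AE v in lebesgue. 0 \<le> f v"
    and e: "0 < \<epsilon>" and h: "0 < h" "h < 1" "AE v in lebesgue. \<epsilon> * f v \<le> h"
  shows "\<exists>a \<beta> w. 0 < \<beta> \<and> same_moments (fermi_dirac \<epsilon> a \<beta> w) f"
proof -
  have m: "0 < mass f" "0 < spread f" using mass_pos[OF f] spread_pos[OF f] by auto
  have fh: "AE v in lebesgue. f v \<le> h / \<epsilon>" using h(3) by eventually_elim (use e in \<open>simp add: field_simps\<close>)
  have "\<exists>a c. 0 < c \<and> c ^ 3 * fd_mass 1 a = \<epsilon> * mass f \<and> c ^ 5 * fd_energy 1 a = \<epsilon> * spread f"
  proof (rule fd_moments_surjective[OF _ _ h(1,2)])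
    fix R :: real assume "0 < R"
    from bathtub[OF f(1,3) fh this, of "mean f"]
    have "\<epsilon> * (mass f * R\<^sup>2 - spread f) \<le> \<epsilon> * (h / \<epsilon> * (8 / 15 * pi * R ^ 5))"
      using e by (intro mult_left_mono) (auto simp: spread_def)
    then show "\<epsilon> * mass f * R\<^sup>2 - \<epsilon> * spread f \<le> h * (8 / 15 * pi * R ^ 5)"
      using e by (simp add: right_diff_distrib mult.assoc)
  qed (use m e in auto)
  then obtain a c where c: "0 < c" "c ^ 3 * fd_mass 1 a = \<epsilon> * mass f" "c ^ 5 * fd_energy 1 a = \<epsilon> * spread f"
    by auto
  have "same_moments (fermi_dirac \<epsilon> (a - ln \<epsilon>) (1 / c\<^sup>2) (mean f)) f"
  proof (rule same_moments_fermi_dirac)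
    show "c ^ 3 * fd_mass \<epsilon> (a - ln \<epsilon>) = mass f"
    proof (rule mult_left_cancel[THEN iffD1])
      show "\<epsilon> * (c ^ 3 * fd_mass \<epsilon> (a - ln \<epsilon>)) = \<epsilon> * mass f"
        unfolding mult.left_commute[of \<epsilon> "c ^ 3"] fd_moments_scale[OF e] diff_add_cancel by (rule c)
    qed (use e in simp)
    show "c ^ 5 * fd_energy \<epsilon> (a - ln \<epsilon>) = spread f"
    proof (rule mult_left_cancel[THEN iffD1])
      show "\<epsilon> * (c ^ 5 * fd_energy \<epsilon> (a - ln \<epsilon>)) = \<epsilon> * spread f"
        unfolding mult.left_commute[of \<epsilon> "c ^ 5"] fd_moments_scale[OF e] diff_add_cancel by (rule c)
    qed (use e in simp)
  qed (use f m c e in auto)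
  then show ?thesis using c by (intro exI[of _ "a - ln \<epsilon>"] exI[of _ "1 / c\<^sup>2"] exI[of _ "mean f"]) simp
qed

text \<open>
  A distribution with a large \<open>a\<close> is nearly as concentrated as a ball filled to the maximal density
  \<open>1 / \<epsilon>\<close>, which is impossible with the moments of a function that stays below \<open>h / \<epsilon>\<close>.
\<close>
theorem fermi_dirac_fugacity_bound:
  assumes f: "f \<in> L12" "AE v in lebesgue. 0 \<le> f v"
    and e: "0 < \<epsilon>" and h: "h < 1" "AE v in lebesgue. \<epsilon> * f v \<le> h"
    and b: "0 < \<beta>" and sm: "same_moments (fermi_dirac \<epsilon> a \<beta> w) f"
  shows "1 + \<epsilon> * exp a \<le> exp (8 * h / (1 - h))"
proof -
  define L where "L = ln (1 + \<epsilon> * exp a)"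
  have Lpos: "0 < L" using e by (simp add: L_def ln_gt_zero)
  define c where "c = 1 / sqrt \<beta>"
  have c: "0 < c" "\<beta> = 1 / c\<^sup>2" using b by (simp_all add: c_def power_divide)
  have fh: "AE v in lebesgue. f v \<le> h / \<epsilon>" using h(2) by eventually_elim (use e in \<open>simp add: field_simps\<close>)
  note M = fermi_dirac_moments_of_match[OF f(1) less_imp_le[OF e] c(1) sm[unfolded c(2)]]
  have ea: "exp (a + ln \<epsilon>) = \<epsilon> * exp a" using e by (simp add: exp_add)
  obtain R where R: "0 < R" "L / (8 + L) * (8 / 15 * pi * R ^ 5)
     \<le> c ^ 3 * fd_mass 1 (a + ln \<epsilon>) * R\<^sup>2 - c ^ 5 * fd_energy 1 (a + ln \<epsilon>)"
    using fd_ball_bound[OF c(1), of "a + ln \<epsilon>"] unfolding ea L_def by auto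
  note R(2)
  also have "c ^ 3 * fd_mass 1 (a + ln \<epsilon>) * R\<^sup>2 - c ^ 5 * fd_energy 1 (a + ln \<epsilon>)
      = \<epsilon> * (mass f * R\<^sup>2 - (LINT v|lebesgue. f v * (norm (v - w))\<^sup>2))"
    by (simp add: M fd_moments_scale[OF e, symmetric] algebra_simps)
  also have "\<dots> \<le> \<epsilon> * (h / \<epsilon> * (8 / 15 * pi * R ^ 5))"
    using bathtub[OF f fh R(1), of w] e by (intro mult_left_mono) auto
  also have "\<dots> = h * (8 / 15 * pi * R ^ 5)" using e by simp
  finally have "L / (8 + L) \<le> h"
    by (rule mult_right_le_imp_le) (use R(1) in simp)
  then have "L \<le> 8 * h / (1 - h)" using h Lpos by (simp add: field_simps)
  then have "exp L \<le> exp (8 * h / (1 - h))" by simp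
  then show ?thesis using e by (simp add: L_def add_pos_pos)
qed

section \<open>Entropy densities and their Bregman divergences\<close>

lemma continuous_on_x_ln_x: "continuous_on {0..} (\<lambda>x::real. x * ln x)"
  unfolding continuous_on_eq_continuous_within
proof
  fix x :: real assume "x \<in> {0..}"
  then show "continuous (at x within {0..}) (\<lambda>x. x * ln x)"
  proof (cases "x = 0")
    case True
    have "((\<lambda>x::real. x * ln x) \<longlongrightarrow> 0) (at 0 within {0..})"
    proof (rule Lim_null_comparison[where g="\<lambda>y. 2 * sqrt y"])
      have "norm (y * ln y) \<le> 2 * sqrt y" if y: "y \<in> {0..}" "y \<noteq> 0" "dist y 0 < 1" for y :: real
      proof -
        have y': "0 < y" "y \<le> 1" using y by (auto simp: dist_real_def)
        \<comment> \<open>A logarithm is dominated by any root.\<close>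
        have "- ln y = 2 * ln (1 / sqrt y)" using y' by (simp add: ln_div ln_sqrt)
        also have "\<dots> \<le> 2 * (1 / sqrt y)" using y' by (intro mult_left_mono less_imp_le ln_less_self) auto
        finally have "y * - ln y \<le> y * (2 * (1 / sqrt y))" using y' by (intro mult_left_mono) auto
        also have "\<dots> = 2 * sqrt y" using y' by (simp add: field_simps)
        finally show "norm (y * ln y) \<le> 2 * sqrt y" using y' by (simp add: abs_mult)
      qed
      then show "\<forall>\<^sub>F y in at 0 within {0..}. norm (y * ln y) \<le> 2 * sqrt (y::real)"
        unfolding eventually_at by (intro exI[of _ 1]) auto
      have "((\<lambda>y. 2 * sqrt y) \<longlongrightarrow> 2 * sqrt 0) (at 0 within {0::real..})" by (intro tendsto_intros)
      then show "((\<lambda>y. 2 * sqrt y) \<longlongrightarrow> 0) (at 0 within {0::real..})" by simp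
    qed
    then show ?thesis using True by (simp add: continuous_within)
  next
    case False
    then show ?thesis by (intro continuous_intros) auto
  qed
qed

text \<open>
  The closed form of \<open>Phi_fd\<close>, continuous up to \<open>x = 0\<close>, where the first term is \<open>0\<close>.
\<close>
definition entropy_density :: "real \<Rightarrow> real \<Rightarrow> real" where
  "entropy_density \<epsilon> x = x * ln x + (if \<epsilon> = 0 then - x else (1 - \<epsilon> * x) * ln (1 - \<epsilon> * x) / \<epsilon>)"

lemma entropy_density_deriv:
  assumes "0 \<le> \<epsilon>" "0 < x" "\<epsilon> * x < 1"
  shows "(entropy_density \<epsilon> has_real_derivative ln (phi_fd \<epsilon> x)) (at x)"
proof -
  have "((\<lambda>x. (1 - \<epsilon> * x) * ln (1 - \<epsilon> * x) / \<epsilon>) has_real_derivative - ln (1 - \<epsilon> * x) - 1) (at x)" if "\<epsilon> \<noteq> 0"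
  proof -
    have "((\<lambda>x. (1 - \<epsilon> * x) * ln (1 - \<epsilon> * x) / \<epsilon>) has_real_derivative
        (- \<epsilon> * ln (1 - \<epsilon> * x) + (- \<epsilon> / (1 - \<epsilon> * x)) * (1 - \<epsilon> * x)) / \<epsilon>) (at x)"
      using assms that by (auto intro!: derivative_eq_intros)
    also have "(- \<epsilon> * ln (1 - \<epsilon> * x) + (- \<epsilon> / (1 - \<epsilon> * x)) * (1 - \<epsilon> * x)) / \<epsilon> = - ln (1 - \<epsilon> * x) - 1"
      using assms that by (simp add: diff_divide_distrib)
    finally show ?thesis .
  qed
  moreover have "(uminus has_real_derivative - 1) (at x)" by (auto intro!: derivative_eq_intros)
  ultimately have "((\<lambda>x. if \<epsilon> = 0 then - x else (1 - \<epsilon> * x) * ln (1 - \<epsilon> * x) / \<epsilon>)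
     has_real_derivative (if \<epsilon> = 0 then - 1 else - ln (1 - \<epsilon> * x) - 1)) (at x)"
    by (cases "\<epsilon> = 0") simp_all
  moreover have "((\<lambda>x. x * ln x) has_real_derivative ln x + 1) (at x)"
    using assms by (auto intro!: derivative_eq_intros)
  ultimately have "(entropy_density \<epsilon> has_real_derivative ln x + 1 + (if \<epsilon> = 0 then - 1 else - ln (1 - \<epsilon> * x) - 1)) (at x)"
    unfolding entropy_density_def[abs_def] by (intro DERIV_add)
  moreover have "ln x + 1 + (if \<epsilon> = 0 then - 1 else - ln (1 - \<epsilon> * x) - 1) = ln (phi_fd \<epsilon> x)"
    using assms by (simp add: phi_fd_def ln_div)
  ultimately show ?thesis by simp
qed

lemma continuous_on_entropy_density:
  assumes "0 \<le> \<epsilon>" "\<epsilon> * x < 1"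
  shows "continuous_on {0..x} (entropy_density \<epsilon>)"
proof -
  have "continuous_on {0..x} (\<lambda>x. x * ln x)"
    by (rule continuous_on_subset[OF continuous_on_x_ln_x]) auto
  moreover have "\<epsilon> * y < 1" if "0 \<le> y" "y \<le> x" for y
    using that assms mult_left_mono[of y x \<epsilon>] by auto
  then have "1 - \<epsilon> * y \<noteq> 0" if "0 \<le> y" "y \<le> x" for y
    using that by force
  ultimately show ?thesis
    unfolding entropy_density_def[abs_def]
    by (cases "\<epsilon> = 0") (auto intro!: continuous_intros)
qed

lemma Phi_fd_eq_entropy_density:
  assumes "0 \<le> \<epsilon>" "0 \<le> x" "\<epsilon> * x < 1"
  shows "Phi_fd \<epsilon> x = entropy_density \<epsilon> x"
proof -
  have "((\<lambda>y. ln (phi_fd \<epsilon> y)) has_integral (entropy_density \<epsilon> x - entropy_density \<epsilon> 0)) {0..x}"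
  proof (rule fundamental_theorem_of_calculus_interior[OF assms(2)])
    show "continuous_on {0..x} (entropy_density \<epsilon>)" by (rule continuous_on_entropy_density[OF assms(1,3)])
    fix y assume "y \<in> {0<..<x}"
    moreover from this have "\<epsilon> * y < 1" using assms mult_left_mono[of y x \<epsilon>] by auto
    ultimately show "(entropy_density \<epsilon> has_vector_derivative ln (phi_fd \<epsilon> y)) (at y)"
      using entropy_density_deriv[OF assms(1), of y] by (simp add: has_real_derivative_iff_has_vector_derivative)
  qed
  then have "Phi_fd \<epsilon> x = entropy_density \<epsilon> x - entropy_density \<epsilon> 0"
    unfolding Phi_fd_def by (rule integral_unique)
  then show ?thesis by (simp add: entropy_density_def)
qed

lemma measurable_entropy_density [measurable]: "entropy_density \<epsilon> \<in> borel_measurable borel"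
  unfolding entropy_density_def[abs_def] by measurable

lemma phi_fd_mono:
  assumes "0 \<le> \<epsilon>" "0 \<le> x" "x \<le> y" "\<epsilon> * y < 1"
  shows "phi_fd \<epsilon> x \<le> phi_fd \<epsilon> y"
  unfolding phi_fd_def using assms mult_left_mono[of x y \<epsilon>] by (intro frac_le) auto

lemma phi_fd_pos: "0 < x \<Longrightarrow> \<epsilon> * x < 1 \<Longrightarrow> 0 < phi_fd \<epsilon> x"
  by (simp add: phi_fd_def)

text \<open>
  The Bregman divergence of \<open>entropy_density \<epsilon>\<close>; recall that \<open>ln (phi_fd \<epsilon> y)\<close> is the derivative
  at \<open>y\<close>.
\<close>
definition bregman :: "real \<Rightarrow> real \<Rightarrow> real \<Rightarrow> real" where
  "bregman \<epsilon> x y = entropy_density \<epsilon> x - entropy_density \<epsilon> y - ln (phi_fd \<epsilon> y) * (x - y)"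

text \<open>
  The point \<open>x = 0\<close> is included, where the functions at hand are continuous but not differentiable.
\<close>
lemma nonneg_of_deriv_sign:
  fixes P :: "real \<Rightarrow> real"
  assumes "0 \<le> x" "0 < y" "P y = 0" and cont: "continuous_on {0..max x y} P"
    and deriv: "\<And>z. 0 < z \<Longrightarrow> z \<le> max x y \<Longrightarrow> (P has_real_derivative P' z) (at z)"
    and up: "\<And>z. y \<le> z \<Longrightarrow> z \<le> x \<Longrightarrow> 0 \<le> P' z"
    and down: "\<And>z. 0 < z \<Longrightarrow> z \<le> y \<Longrightarrow> P' z \<le> 0"
  shows "0 \<le> P x"
proof (cases "y \<le> x")
  case True
  have "P y \<le> P x"
  proof (rule DERIV_nonneg_imp_increasing_open[where f=P, OF True])
    show "\<exists>d. (P has_real_derivative d) (at z) \<and> 0 \<le> d" if "y < z" "z < x" for z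
      using that assms(2) by (intro exI[of _ "P' z"] conjI deriv up) auto
  qed (rule continuous_on_subset[OF cont], use assms in auto)
  then show ?thesis using assms by simp
next
  case False
  have "P y \<le> P x"
  proof (rule DERIV_nonpos_imp_decreasing_open[where f=P])
    show "\<exists>d. (P has_real_derivative d) (at z) \<and> d \<le> 0" if "x < z" "z < y" for z
      using that assms(1) by (intro exI[of _ "P' z"] conjI deriv down) auto
  qed (use False continuous_on_subset[OF cont] assms in auto)
  then show ?thesis using assms by simp
qed

lemma bregman_nonneg:
  assumes e: "0 \<le> \<epsilon>" and x: "0 \<le> x" "\<epsilon> * x < 1" and y: "0 < y" "\<epsilon> * y < 1"
  shows "0 \<le> bregman \<epsilon> x y"
proof (rule nonneg_of_deriv_sign[of x y _ "\<lambda>z. ln (phi_fd \<epsilon> z) - ln (phi_fd \<epsilon> y)"])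
  have lt: "\<epsilon> * max x y < 1" using x y by (simp add: max_def)
  have lt': "\<epsilon> * z < 1" if "0 < z" "z \<le> max x y" for z
    using that lt mult_left_mono[of z "max x y" \<epsilon>] e by auto
  show "continuous_on {0..max x y} (\<lambda>x. bregman \<epsilon> x y)"
    unfolding bregman_def by (intro continuous_intros continuous_on_entropy_density e lt)
  show "((\<lambda>x. bregman \<epsilon> x y) has_real_derivative ln (phi_fd \<epsilon> z) - ln (phi_fd \<epsilon> y)) (at z)"
    if "0 < z" "z \<le> max x y" for z
    unfolding bregman_def using lt'[OF that] that
    by (auto intro!: derivative_eq_intros entropy_density_deriv e)
  show "0 \<le> ln (phi_fd \<epsilon> z) - ln (phi_fd \<epsilon> y)" if "y \<le> z" "z \<le> x" for z
    using phi_fd_mono[of \<epsilon> y z] phi_fd_pos[of y \<epsilon>] phi_fd_pos[of z \<epsilon>] lt'[of z] that y e by simp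
  show "ln (phi_fd \<epsilon> z) - ln (phi_fd \<epsilon> y) \<le> 0" if "0 < z" "z \<le> y" for z
    using phi_fd_mono[of \<epsilon> z y] phi_fd_pos[of y \<epsilon>] phi_fd_pos[of z \<epsilon>] lt'[of z] that y e by simp
qed (use x y in \<open>simp_all add: bregman_def\<close>)

text \<open>
  The derivative in \<open>x\<close> of the difference of the two sides is
  \<open>(ln (phi_fd \<epsilon> x) - ln (phi_fd \<epsilon> y)) * (C - 1 / (1 - \<epsilon> * x)\<^sup>2)\<close>, whose sign is that of \<open>x - y\<close>,
  and the difference vanishes at \<open>x = y\<close>.
\<close>
lemma bregman_phi_le:
  assumes e: "0 < \<epsilon>" and x: "0 \<le> x" "\<epsilon> * x < 1" and y: "0 < y" "\<epsilon> * y < 1"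
    and C: "1 / (1 - \<epsilon> * x)\<^sup>2 \<le> C" "1 / (1 - \<epsilon> * y)\<^sup>2 \<le> C"
  shows "bregman 0 (phi_fd \<epsilon> x) (phi_fd \<epsilon> y) \<le> C * bregman \<epsilon> x y"
proof -
  define u where "u = max x y"
  have u: "0 < u" "\<epsilon> * u < 1" "1 / (1 - \<epsilon> * u)\<^sup>2 \<le> C"
    using x y C by (auto simp: u_def max_def)
  have lt: "\<epsilon> * z < 1" if "z \<le> u" for z
    using mult_left_mono[OF that, of \<epsilon>] u(2) e by linarith
  define l where "l z = ln (phi_fd \<epsilon> z) - ln (phi_fd \<epsilon> y)" for z
  define P where "P z = C * bregman \<epsilon> z y - bregman 0 (phi_fd \<epsilon> z) (phi_fd \<epsilon> y)" for z
  have slope: "1 / (1 - \<epsilon> * z)\<^sup>2 \<le> C" if "z \<le> u" for z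
  proof -
    have "0 < 1 - \<epsilon> * u" "1 - \<epsilon> * u \<le> 1 - \<epsilon> * z"
      using mult_left_mono[OF that, of \<epsilon>] u(2) e by auto
    then have "1 / (1 - \<epsilon> * z)\<^sup>2 \<le> 1 / (1 - \<epsilon> * u)\<^sup>2"
      by (intro divide_left_mono power_mono mult_pos_pos zero_less_power) auto
    then show ?thesis using u by simp
  qed
  have phi_cont: "continuous_on {0..u} (phi_fd \<epsilon>)"
    unfolding phi_fd_def[abs_def] using lt by (intro continuous_intros) force
  have "0 \<le> P x"
  proof (rule nonneg_of_deriv_sign[of x y _ "\<lambda>z. l z * (C - 1 / (1 - \<epsilon> * z)\<^sup>2)"])
    have "continuous_on {0..u} (\<lambda>z. entropy_density 0 (phi_fd \<epsilon> z))"
    proof (rule continuous_on_compose2[OF continuous_on_entropy_density phi_cont])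
      show "phi_fd \<epsilon> ` {0..u} \<subseteq> {0..phi_fd \<epsilon> u}"
        using u e lt phi_fd_mono[of \<epsilon> 0] phi_fd_mono[of \<epsilon> _ u] by (force simp: phi_fd_def)
    qed auto
    then show "continuous_on {0..max x y} P"
      unfolding P_def bregman_def u_def[symmetric]
      by (intro continuous_intros continuous_on_entropy_density phi_cont u) (use e in auto)
    show "(P has_real_derivative l z * (C - 1 / (1 - \<epsilon> * z)\<^sup>2)) (at z)" if z: "0 < z" "z \<le> max x y" for z
    proof -
      have zu: "\<epsilon> * z < 1" using lt z by (simp add: u_def)
      have "(phi_fd \<epsilon> has_real_derivative 1 / (1 - \<epsilon> * z)\<^sup>2) (at z)"
        unfolding phi_fd_def[abs_def] using zu
        by (auto intro!: derivative_eq_intros simp: field_simps power2_eq_square)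
      moreover have "(entropy_density 0 has_real_derivative ln (phi_fd \<epsilon> z)) (at (phi_fd \<epsilon> z))"
        using entropy_density_deriv[of 0 "phi_fd \<epsilon> z"] phi_fd_pos[OF z(1) zu] by (simp add: phi_fd_def)
      ultimately show ?thesis
        unfolding P_def bregman_def l_def
        using DERIV_chain2[of "entropy_density 0" "ln (phi_fd \<epsilon> z)" "phi_fd \<epsilon>" z "1 / (1 - \<epsilon> * z)\<^sup>2" UNIV]
        by (auto intro!: derivative_eq_intros entropy_density_deriv zu z less_imp_le[OF e] simp: algebra_simps diff_divide_distrib phi_fd_def[of 0])
    qed
    show "0 \<le> l z * (C - 1 / (1 - \<epsilon> * z)\<^sup>2)" if "y \<le> z" "z \<le> x" for z
      using phi_fd_mono[of \<epsilon> y z] phi_fd_pos[of y \<epsilon>] phi_fd_pos[of z \<epsilon>] lt[of z] that y e slope[of z]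
      by (intro mult_nonneg_nonneg) (auto simp: l_def u_def)
    show "l z * (C - 1 / (1 - \<epsilon> * z)\<^sup>2) \<le> 0" if "0 < z" "z \<le> y" for z
      using phi_fd_mono[of \<epsilon> z y] phi_fd_pos[of y \<epsilon>] phi_fd_pos[of z \<epsilon>] lt[of z] that y e slope[of z]
      by (intro mult_nonpos_nonneg) (auto simp: l_def u_def)
  qed (use x y in \<open>simp_all add: P_def bregman_def\<close>)
  then show ?thesis by (simp add: P_def)
qed

text \<open>
  A convex function vanishing at \<open>0\<close>: the divergence of \<open>0\<close> from \<open>x\<close> is nonnegative.
\<close>
lemma entropy_density_upper:
  assumes "0 \<le> \<epsilon>" "0 \<le> x" "\<epsilon> * x < 1"
  shows "entropy_density \<epsilon> x \<le> x * ln (phi_fd \<epsilon> x)"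
proof (cases "x = 0")
  case False
  then have "0 \<le> bregman \<epsilon> 0 x" using assms by (intro bregman_nonneg) auto
  moreover have "entropy_density \<epsilon> 0 = 0" by (simp add: entropy_density_def)
  ultimately show ?thesis by (simp add: bregman_def mult.commute)
qed (simp add: entropy_density_def)

text \<open>
  The Legendre transform of the entropy density is \<open>ln (1 + \<epsilon> * exp l) / \<epsilon>\<close> (or \<open>exp l\<close> if
  \<open>\<epsilon> = 0\<close>), hence at most \<open>exp l\<close>.
\<close>
lemma entropy_density_lower:
  assumes "0 \<le> \<epsilon>" "0 < x" "\<epsilon> * x < 1"
  shows "x * ln (phi_fd \<epsilon> x) - phi_fd \<epsilon> x \<le> entropy_density \<epsilon> x"
proof (cases "\<epsilon> = 0")
  case True
  then show ?thesis by (simp add: entropy_density_def phi_fd_def)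
next
  case False
  define q where "q = 1 - \<epsilon> * x"
  have q: "0 < q" using assms by (simp add: q_def)
  have "ln (1 / q) \<le> 1 / q - 1" using ln_le_minus_one[of "1 / q"] q by simp
  then have "(1 - 1 / q) / \<epsilon> \<le> ln q / \<epsilon>"
    using q assms False by (intro divide_right_mono) (auto simp: ln_div)
  moreover have "(1 - 1 / q) / \<epsilon> = - phi_fd \<epsilon> x"
    using False q by (simp add: phi_fd_def field_simps q_def)
  moreover have "x * ln (phi_fd \<epsilon> x) = x * ln x - x * ln q"
    using q assms by (simp add: phi_fd_def ln_div q_def[symmetric] right_diff_distrib)
  moreover have "entropy_density \<epsilon> x = x * ln x - x * ln q + ln q / \<epsilon>"
    using False by (simp add: entropy_density_def q_def field_simps)
  ultimately show ?thesis by simp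
qed

section \<open>Comparison of relative entropies\<close>

lemma fermi_dirac_facts:
  assumes "0 \<le> \<epsilon>"
  shows "\<epsilon> * fermi_dirac \<epsilon> a \<beta> w v < 1"
    and "phi_fd \<epsilon> (fermi_dirac \<epsilon> a \<beta> w v) = fermi_dirac 0 a \<beta> w v"
    and "ln (phi_fd \<epsilon> (fermi_dirac \<epsilon> a \<beta> w v)) = a + (- \<beta>) * (norm (v - w))\<^sup>2"
    and "1 / (1 - \<epsilon> * fermi_dirac \<epsilon> a \<beta> w v) = 1 + \<epsilon> * fermi_dirac 0 a \<beta> w v"
proof -
  define E where "E = exp (a - \<beta> * (norm (v - w))\<^sup>2)"
  have E: "0 < 1 + \<epsilon> * E" unfolding E_def by (rule fd_denom_pos[OF assms])
  have M: "fermi_dirac \<epsilon> a \<beta> w v = E / (1 + \<epsilon> * E)" by (simp add: fermi_dirac_def fd_profile_def E_def)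
  have N: "fermi_dirac 0 a \<beta> w v = E" by (simp add: fermi_dirac_def fd_profile_def E_def)
  show "\<epsilon> * fermi_dirac \<epsilon> a \<beta> w v < 1" using E by (simp add: M)
  have q: "1 - \<epsilon> * fermi_dirac \<epsilon> a \<beta> w v = 1 / (1 + \<epsilon> * E)" using E by (simp add: M field_simps)
  then show "1 / (1 - \<epsilon> * fermi_dirac \<epsilon> a \<beta> w v) = 1 + \<epsilon> * fermi_dirac 0 a \<beta> w v"
    using E by (simp add: N)
  show phi: "phi_fd \<epsilon> (fermi_dirac \<epsilon> a \<beta> w v) = fermi_dirac 0 a \<beta> w v"
    unfolding phi_fd_def q using E by (simp add: M N)
  show "ln (phi_fd \<epsilon> (fermi_dirac \<epsilon> a \<beta> w v)) = a + (- \<beta>) * (norm (v - w))\<^sup>2"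
    unfolding phi N by (simp add: E_def)
qed

lemma L12_measurable: "f \<in> L12 \<Longrightarrow> f \<in> borel_measurable lebesgue"
  by (simp add: L12_def)

lemma integrable_entropy_fermi_dirac:
  assumes e: "0 \<le> \<epsilon>" and b: "0 < \<beta>"
  shows "integrable lebesgue (\<lambda>v. entropy_density \<epsilon> (fermi_dirac \<epsilon> a \<beta> w v))"
proof (rule Bochner_Integration.integrable_bound)
  let ?M = "fermi_dirac \<epsilon> a \<beta> w" and ?N = "fermi_dirac 0 a \<beta> w"
  let ?l = "\<lambda>v. ?M v * (a + (- \<beta>) * (norm (v - w))\<^sup>2)"
  have L: "?M \<in> L12" "?N \<in> L12" using e b by (auto intro: fermi_dirac_L12)
  show "integrable lebesgue (\<lambda>v. \<bar>?l v\<bar> + ?N v)"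
    using L12_quadratic(1)[OF L(1), of a "- \<beta>" w] L12_integrable(1)[OF L(2)]
    by (intro Bochner_Integration.integrable_add integrable_abs)
  show "AE v in lebesgue. norm (entropy_density \<epsilon> (?M v)) \<le> norm (\<bar>?l v\<bar> + ?N v)"
  proof (rule AE_I2)
    fix v
    have "entropy_density \<epsilon> (?M v) \<le> ?l v" "?l v - ?N v \<le> entropy_density \<epsilon> (?M v)"
      using entropy_density_upper[OF e, of "?M v"] entropy_density_lower[OF e, of "?M v"]
        fermi_dirac_pos[OF e, of a \<beta> w v] fermi_dirac_facts[OF e, of a \<beta> w v] by simp_all
    moreover have "0 < ?N v" by (rule fermi_dirac_pos) simp
    ultimately show "norm (entropy_density \<epsilon> (?M v)) \<le> norm (\<bar>?l v\<bar> + ?N v)" by simp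
  qed
qed (measurable, intro measurable_completion, simp)

lemma integrable_bregman:
  fixes a \<beta> :: real and w :: "real^3"
  assumes e: "0 \<le> \<epsilon>" and b: "0 < \<beta>" and f: "f \<in> L12"
    and H: "integrable lebesgue (\<lambda>v. entropy_density \<epsilon> (f v))"
  defines "M \<equiv> fermi_dirac \<epsilon> a \<beta> w"
  defines "l \<equiv> \<lambda>v. a + (- \<beta>) * (norm (v - w))\<^sup>2"
  shows "integrable lebesgue (\<lambda>v. bregman \<epsilon> (f v) (M v))"
    and "(LINT v|lebesgue. bregman \<epsilon> (f v) (M v)) = (LINT v|lebesgue. entropy_density \<epsilon> (f v))
      - (LINT v|lebesgue. entropy_density \<epsilon> (M v)) - ((LINT v|lebesgue. f v * l v) - (LINT v|lebesgue. M v * l v))"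
proof -
  have eq: "bregman \<epsilon> (f v) (M v) = entropy_density \<epsilon> (f v) - entropy_density \<epsilon> (M v) - (f v * l v - M v * l v)" for v
    unfolding bregman_def M_def l_def fermi_dirac_facts(3)[OF e] by (simp add: algebra_simps)
  have M: "M \<in> L12" unfolding M_def by (rule fermi_dirac_L12[OF e b])
  have I: "integrable lebesgue (\<lambda>v. entropy_density \<epsilon> (M v))"
    unfolding M_def by (rule integrable_entropy_fermi_dirac[OF e b])
  have J: "integrable lebesgue (\<lambda>v. f v * l v)" "integrable lebesgue (\<lambda>v. M v * l v)"
    unfolding l_def by (rule L12_quadratic f M)+
  show "integrable lebesgue (\<lambda>v. bregman \<epsilon> (f v) (M v))"
    unfolding eq by (intro Bochner_Integration.integrable_diff H I J)
  show "(LINT v|lebesgue. bregman \<epsilon> (f v) (M v)) = (LINT v|lebesgue. entropy_density \<epsilon> (f v))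
      - (LINT v|lebesgue. entropy_density \<epsilon> (M v)) - ((LINT v|lebesgue. f v * l v) - (LINT v|lebesgue. M v * l v))"
    unfolding eq
    by (simp only: Bochner_Integration.integral_diff[OF Bochner_Integration.integrable_diff[OF H I] Bochner_Integration.integrable_diff[OF J]]
        Bochner_Integration.integral_diff[OF H I] Bochner_Integration.integral_diff[OF J])
qed

text \<open>
  The upper bound comes from the bound on \<open>phi_fd \<epsilon> (f v)\<close>. For the lower bound, where \<open>f\<close> may
  decay slowly, the divergence from any fixed Fermi-Dirac distribution is nonnegative, so the entropy
  density is above an affine function of \<open>f v\<close> with quadratically growing slope.
\<close>
lemma integrable_entropy_density:
  assumes e: "0 \<le> \<epsilon>" and f: "f \<in> L12" and nn: "AE v in lebesgue. 0 \<le> f v"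
    and lt: "AE v in lebesgue. \<epsilon> * f v < 1" and K: "AE v in lebesgue. phi_fd \<epsilon> (f v) \<le> exp K"
  shows "integrable lebesgue (\<lambda>v. entropy_density \<epsilon> (f v))"
proof (rule Bochner_Integration.integrable_bound)
  let ?M = "fermi_dirac \<epsilon> 0 1 0"
  let ?l = "\<lambda>v. 0 + (- 1) * (norm (v - 0 :: real^3))\<^sup>2 :: real"
  have M: "?M \<in> L12" by (rule fermi_dirac_L12[OF e]) simp
  show "integrable lebesgue (\<lambda>v. \<bar>K * f v\<bar> + (\<bar>entropy_density \<epsilon> (?M v)\<bar> + (\<bar>f v * ?l v\<bar> + \<bar>?M v * ?l v\<bar>)))"
    using L12_quadratic(1)[OF f, of 0 "- 1" 0] L12_quadratic(1)[OF M, of 0 "- 1" 0] L12_integrable(1)[OF f]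
      integrable_entropy_fermi_dirac[OF e zero_less_one, of 0 0]
    by (intro Bochner_Integration.integrable_add integrable_abs integrable_mult_right)
  show "AE v in lebesgue. norm (entropy_density \<epsilon> (f v))
     \<le> norm (\<bar>K * f v\<bar> + (\<bar>entropy_density \<epsilon> (?M v)\<bar> + (\<bar>f v * ?l v\<bar> + \<bar>?M v * ?l v\<bar>)))"
    using nn lt K
  proof eventually_elim
    case (elim v)
    have "entropy_density \<epsilon> (f v) \<le> f v * K"
    proof (cases "f v = 0")
      case False
      then have "ln (phi_fd \<epsilon> (f v)) \<le> K" using elim phi_fd_pos[of "f v" \<epsilon>] by (intro ln_leI) auto
      then have "f v * ln (phi_fd \<epsilon> (f v)) \<le> f v * K" using elim by (intro mult_left_mono) auto
      then show ?thesis using entropy_density_upper[OF e elim(1,2)] by simp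
    qed (simp add: entropy_density_def)
    moreover have "0 \<le> bregman \<epsilon> (f v) (?M v)"
      using elim by (intro bregman_nonneg e fermi_dirac_pos fermi_dirac_facts)
    then have "entropy_density \<epsilon> (?M v) + (f v * ?l v - ?M v * ?l v) \<le> entropy_density \<epsilon> (f v)"
      unfolding bregman_def fermi_dirac_facts(3)[OF e] by (simp add: algebra_simps)
    ultimately show ?case by (simp only: real_norm_def mult.commute[of K])
  qed
qed (use L12_measurable[OF f] in measurable)

lemma entropy_fd_eq:
  assumes e: "0 \<le> \<epsilon>" and f: "f \<in> L12" and nn: "AE v in lebesgue. 0 \<le> f v"
    and lt: "AE v in lebesgue. \<epsilon> * f v < 1"
  shows "entropy_fd \<epsilon> f = (LINT v|lebesgue. entropy_density \<epsilon> (f v))"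
proof -
  have [measurable]: "(\<lambda>v. entropy_density \<epsilon> (f v)) \<in> borel_measurable lebesgue"
    using L12_measurable[OF f] by measurable
  have eq: "AE v in lebesgue. entropy_density \<epsilon> (f v) = Phi_fd \<epsilon> (f v)"
    using nn lt by eventually_elim (simp add: Phi_fd_eq_entropy_density e)
  have "(\<lambda>v. Phi_fd \<epsilon> (f v)) \<in> borel_measurable lebesgue"
    by (rule borel_measurable_AE[OF _ eq]) measurable
  then show ?thesis unfolding entropy_fd_def
    using eq by (intro integral_cong_AE) (auto elim: eventually_mono)
qed

lemma entropy_fermi_dirac:
  assumes e: "0 \<le> \<epsilon>" and b: "0 < \<beta>"
  shows "entropy_fd \<epsilon> (fermi_dirac \<epsilon> a \<beta> w) = (LINT v|lebesgue. entropy_density \<epsilon> (fermi_dirac \<epsilon> a \<beta> w v))"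
  using fermi_dirac_pos[OF e] fermi_dirac_facts(1)[OF e]
  by (intro entropy_fd_eq e fermi_dirac_L12 b) (auto intro!: AE_I2 less_imp_le)

lemma relative_entropy_eq_bregman:
  assumes e: "0 \<le> \<epsilon>" and b: "0 < \<beta>" and f: "f \<in> L12" and nn: "AE v in lebesgue. 0 \<le> f v"
    and lt: "AE v in lebesgue. \<epsilon> * f v < 1" and H: "integrable lebesgue (\<lambda>v. entropy_density \<epsilon> (f v))"
    and sm: "same_moments (fermi_dirac \<epsilon> a \<beta> w) f"
  shows "rel_entropy_fd \<epsilon> f (fermi_dirac \<epsilon> a \<beta> w) = (LINT v|lebesgue. bregman \<epsilon> (f v) (fermi_dirac \<epsilon> a \<beta> w v))"
  using same_moments_quadratic[OF fermi_dirac_L12[OF e b] f sm, of a "- \<beta>" w]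
  by (simp add: rel_entropy_fd_def entropy_fermi_dirac[OF e b] entropy_fd_eq[OF e f nn lt]
      integrable_bregman(2)[OF e b f H])

text \<open>
  The difference of the two sides is the divergence of the equilibrium from the other distribution.
\<close>
lemma relative_entropy_le_bregman:
  assumes e: "0 \<le> \<epsilon>" and b: "0 < \<beta>" "0 < \<beta>'" and f: "f \<in> L12" and nn: "AE v in lebesgue. 0 \<le> f v"
    and lt: "AE v in lebesgue. \<epsilon> * f v < 1" and H: "integrable lebesgue (\<lambda>v. entropy_density \<epsilon> (f v))"
    and sm: "same_moments (fermi_dirac \<epsilon> a \<beta> w) f"
  shows "rel_entropy_fd \<epsilon> f (fermi_dirac \<epsilon> a \<beta> w) \<le> (LINT v|lebesgue. bregman \<epsilon> (f v) (fermi_dirac \<epsilon> a' \<beta>' w' v))"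
proof -
  let ?M = "fermi_dirac \<epsilon> a \<beta> w" and ?N = "fermi_dirac \<epsilon> a' \<beta>' w'"
  have M: "?M \<in> L12" by (rule fermi_dirac_L12[OF e b(1)])
  have "0 \<le> (LINT v|lebesgue. bregman \<epsilon> (?M v) (?N v))"
    by (intro integral_nonneg_AE AE_I2 bregman_nonneg e fermi_dirac_pos fermi_dirac_facts less_imp_le)
  then show ?thesis
    using same_moments_quadratic[OF M f sm, of a' "- \<beta>'" w']
    by (simp add: rel_entropy_fd_def entropy_fermi_dirac[OF e b(1)] entropy_fd_eq[OF e f nn lt]
      integrable_bregman(2)[OF e b(2) f H] integrable_bregman(2)[OF e b(2) M integrable_entropy_fermi_dirac[OF e b(1)]])
qed

theorem proposition2:
  fixes \<kappa>\<^sub>0 \<epsilon> :: real and f :: "real^3 \<Rightarrow> real"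
  assumes "0 < \<kappa>\<^sub>0" and "\<kappa>\<^sub>0 < 1" and "\<epsilon> > 0"
    and "f \<in> L12"
    and "\<not> (AE v in lebesgue. f v = 0)"
    and "AE v in lebesgue. f v \<ge> 0"
    and "AE v in lebesgue. 1 - \<epsilon> * f v \<ge> \<kappa>\<^sub>0"
  shows "rel_entropy_fd 0 (\<lambda>v. f v / (1 - \<epsilon> * f v)) (maxwellian (\<lambda>v. f v / (1 - \<epsilon> * f v)))
       \<le> C0 \<kappa>\<^sub>0 * rel_entropy_fd \<epsilon> f (equilibrium \<epsilon> f)"
proof -
  note \<kappa> = assms(1,2) and e = assms(3) and f = assms(4) and nz = assms(5) and nn = assms(6) and gap = assms(7)
  have e0: "0 \<le> \<epsilon>" using e by simp
  have lt: "AE v in lebesgue. \<epsilon> * f v < 1" using gap by eventually_elim (use \<kappa> in simp)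
  define g where "g v = phi_fd \<epsilon> (f v)" for v
  have g_eq: "(\<lambda>v. f v / (1 - \<epsilon> * f v)) = g" by (simp add: g_def[abs_def] phi_fd_def)
  have g_nn: "AE v in lebesgue. 0 \<le> g v" 
    using nn lt by eventually_elim (simp add: g_def phi_fd_def)
  have g_le: "AE v in lebesgue. g v \<le> f v / \<kappa>\<^sub>0"
    using nn gap by eventually_elim (use \<kappa> in \<open>auto simp: g_def phi_fd_def intro!: divide_left_mono\<close>)
  have g: "g \<in> L12"
    unfolding L12_def
  proof (intro CollectI conjI)
    show [measurable]: "g \<in> borel_measurable lebesgue"
      unfolding g_def[abs_def] phi_fd_def using L12_measurable[OF f] by measurable
    have [measurable]: "(\<lambda>v. v) \<in> borel_measurable (lebesgue :: (real^3) measure)"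
      by (intro measurable_completion) simp
    have "integrable lebesgue (\<lambda>v. \<bar>f v\<bar> * (1 + (norm v)\<^sup>2))" using f by (simp add: L12_def)
    then have "integrable lebesgue (\<lambda>v. 1 / \<kappa>\<^sub>0 * (\<bar>f v\<bar> * (1 + (norm v)\<^sup>2)))" by (rule integrable_mult_right)
    then show "integrable lebesgue (\<lambda>v. \<bar>g v\<bar> * (1 + (norm v)\<^sup>2))"
    proof (rule Bochner_Integration.integrable_bound)
      show "AE v in lebesgue. norm (\<bar>g v\<bar> * (1 + (norm v)\<^sup>2)) \<le> norm (1 / \<kappa>\<^sub>0 * (\<bar>f v\<bar> * (1 + (norm v)\<^sup>2)))"
        using g_nn g_le nn
      proof eventually_elim
        case (elim v)
        have "g v * (1 + (norm v)\<^sup>2) \<le> f v / \<kappa>\<^sub>0 * (1 + (norm v)\<^sup>2)"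
          using elim by (intro mult_right_mono) auto
        then show ?case using elim \<kappa> by (simp add: abs_mult)
      qed
    qed measurable
  qed
  have g_nz: "\<not> (AE v in lebesgue. g v = 0)"
  proof
    assume "AE v in lebesgue. g v = 0"
    then have "AE v in lebesgue. f v = 0" using lt by eventually_elim (simp add: g_def phi_fd_def)
    with nz show False by simp
  qed

  obtain a \<beta> w where b: "0 < \<beta>" and sm: "same_moments (fermi_dirac \<epsilon> a \<beta> w) f"
  proof -
    have "AE v in lebesgue. \<epsilon> * f v \<le> 1 - \<kappa>\<^sub>0" using gap by eventually_elim simp
    then show ?thesis
      using fermi_dirac_equilibrium_exists[OF f nz nn e, of "1 - \<kappa>\<^sub>0"] \<kappa> that by auto
  qed
  obtain a' \<beta>' w' where b': "0 < \<beta>'" and sm': "same_moments (fermi_dirac 0 a' \<beta>' w') g"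
    using maxwellian_exists[OF g g_nz g_nn] by auto
  let ?M = "fermi_dirac \<epsilon> a \<beta> w" and ?N = "fermi_dirac 0 a \<beta> w"
  have M_eq: "equilibrium \<epsilon> f = ?M" by (rule equilibriumI[OF e0 b sm])
  have G_eq: "maxwellian g = fermi_dirac 0 a' \<beta>' w'" unfolding maxwellian_def by (rule equilibriumI[OF _ b' sm']) simp

  \<comment> \<open>An upper bound for \<open>g\<close>, which makes both entropies finite.\<close>
  define K where "K = ln ((1 - \<kappa>\<^sub>0) / \<epsilon> / \<kappa>\<^sub>0)"
  have g_bd: "AE v in lebesgue. g v \<le> exp K"
    using g_le gap
  proof eventually_elim
    case (elim v)
    have "f v \<le> (1 - \<kappa>\<^sub>0) / \<epsilon>" using elim e by (simp add: field_simps)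
    then have "f v / \<kappa>\<^sub>0 \<le> (1 - \<kappa>\<^sub>0) / \<epsilon> / \<kappa>\<^sub>0" using \<kappa> by (intro divide_right_mono) auto
    then show ?case using elim \<kappa> e by (simp add: K_def)
  qed
  have Hf: "integrable lebesgue (\<lambda>v. entropy_density \<epsilon> (f v))"
    using g_bd unfolding g_def by (rule integrable_entropy_density[OF e0 f nn lt])
  have Hg: "integrable lebesgue (\<lambda>v. entropy_density 0 (g v))"
    using g_bd by (intro integrable_entropy_density[OF _ g g_nn]) (simp_all add: phi_fd_def)

  have C: "1 / (1 - \<epsilon> * ?M v)\<^sup>2 \<le> C0 \<kappa>\<^sub>0" for v
  proof -
    have "?N v \<le> exp a" using b by (simp add: fermi_dirac_def fd_profile_def)
    then have "1 + \<epsilon> * ?N v \<le> 1 + \<epsilon> * exp a" using e by simp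
    also have "\<dots> \<le> exp (8 * (1 - \<kappa>\<^sub>0) / (1 - (1 - \<kappa>\<^sub>0)))"
      using gap \<kappa> by (intro fermi_dirac_fugacity_bound[OF f nn e _ _ b sm]) (auto elim: eventually_mono)
    finally have "1 + \<epsilon> * ?N v \<le> exp (8 * (inverse \<kappa>\<^sub>0 - 1))"
      using \<kappa> by (simp add: field_simps)
    then have "(1 + \<epsilon> * ?N v)\<^sup>2 \<le> (exp (8 * (inverse \<kappa>\<^sub>0 - 1)))\<^sup>2"
      using e fermi_dirac_pos[of 0 a \<beta> w v] by (intro power_mono) auto
    also have "\<dots> = C0 \<kappa>\<^sub>0" by (simp add: C0_def flip: exp_double)
    finally show ?thesis
      using fermi_dirac_facts(4)[OF e0, of a \<beta> w v] by (simp flip: power_one_over)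
  qed
  have C': "1 / (1 - \<epsilon> * x)\<^sup>2 \<le> C0 \<kappa>\<^sub>0" if "\<kappa>\<^sub>0 \<le> 1 - \<epsilon> * x" for x
  proof -
    have k1: "1 \<le> inverse \<kappa>\<^sub>0" using \<kappa> by (simp add: one_le_inverse)
    have "1 / (1 - \<epsilon> * x) \<le> inverse \<kappa>\<^sub>0" using that \<kappa> by (simp add: frac_le inverse_eq_divide)
    also have "\<dots> \<le> exp (inverse \<kappa>\<^sub>0 - 1)" using exp_ge_add_one_self[of "inverse \<kappa>\<^sub>0 - 1"] by simp
    also have "\<dots> \<le> exp (8 * (inverse \<kappa>\<^sub>0 - 1))" using k1 by simp
    finally have "(1 / (1 - \<epsilon> * x))\<^sup>2 \<le> (exp (8 * (inverse \<kappa>\<^sub>0 - 1)))\<^sup>2"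
      using that \<kappa> by (intro power_mono) auto
    also have "\<dots> = C0 \<kappa>\<^sub>0" by (simp add: C0_def flip: exp_double)
    finally show ?thesis by (simp add: power_one_over)
  qed

  have "rel_entropy_fd 0 g (maxwellian g) \<le> (LINT v|lebesgue. bregman 0 (g v) (?N v))"
    unfolding G_eq by (rule relative_entropy_le_bregman[OF _ b' b g g_nn _ Hg sm']) simp_all
  also have "\<dots> \<le> (LINT v|lebesgue. C0 \<kappa>\<^sub>0 * bregman \<epsilon> (f v) (?M v))"
  proof (rule integral_mono_AE)
    show "integrable lebesgue (\<lambda>v. bregman 0 (g v) (?N v))"
      by (rule integrable_bregman[OF _ b g Hg]) simp
    show "integrable lebesgue (\<lambda>v. C0 \<kappa>\<^sub>0 * bregman \<epsilon> (f v) (?M v))"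
      by (intro integrable_mult_right integrable_bregman e0 b f Hf)
    show "AE v in lebesgue. bregman 0 (g v) (?N v) \<le> C0 \<kappa>\<^sub>0 * bregman \<epsilon> (f v) (?M v)"
      using nn gap lt
    proof eventually_elim
      case (elim v)
      have "bregman 0 (phi_fd \<epsilon> (f v)) (phi_fd \<epsilon> (?M v)) \<le> C0 \<kappa>\<^sub>0 * bregman \<epsilon> (f v) (?M v)"
        using elim by (intro bregman_phi_le e fermi_dirac_pos fermi_dirac_facts e0 C C') auto
      then show ?case by (simp add: g_def fermi_dirac_facts(2)[OF e0])
    qed
  qed
  also have "\<dots> = C0 \<kappa>\<^sub>0 * rel_entropy_fd \<epsilon> f ?M"
    by (simp add: relative_entropy_eq_bregman[OF e0 b f nn lt Hf sm])
  finally show ?thesis unfolding g_eq M_eq .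
qed

end
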